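(* As $n\to\infty$, $$F_6(n)\leq \pi(n)+\pi(n/2)+n^{2/3}(\log n)^{2^{1/3}-1/3+o(1)},$$ where $F_6(n)$ denotes the maximal size of a set $A\subseteq\{1,2,\dots,n\}$ such that no product of six pairwise distinct elements of $A$ is a perfect square.
   Context: $F_{6}(n)$ is the maximal number of elements that can be chosen from $\{1,2,\dots,n\}$ so that no product of $6$ distinct chosen elements is a perfect square. $\pi(x)$ is the number of primes not exceeding the real number $x$, and $\log$ is the natural logarithm. The symbol $o(1)$ denotes a function of $n$ tending to $0$ as $n\to\infty$; that is, the bound means: for every $\varepsilon>0$ there is $n_0$ such that for all integers $n\geq n_0$, $F_6(n)\leq \pi(n)+\pi(n/2)+n^{2/3}(\log n)^{2^{1/3}-1/3+\varepsilon}$. *)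

theory Defs
  imports "HOL-Analysis.Analysis" "HOL-Computational_Algebra.Computational_Algebra"
begin

definition prime_pi :: "real \<Rightarrow> nat" where
  "prime_pi x = card {p :: nat. prime p \<and> real p \<le> x}"

definition no_square_product :: "nat \<Rightarrow> nat set \<Rightarrow> bool" where
  "no_square_product k A \<longleftrightarrow>
     (\<forall>S. S \<subseteq> A \<and> card S = k \<longrightarrow> \<not> is_square (\<Prod>S))"

text \<open>For \<open>k > 0\<close> the empty set is admissible, so the maximum ranges over a nonempty finite set.\<close>

definition F :: "nat \<Rightarrow> nat \<Rightarrow> nat" where
  "F k n = Max {card A | A. A \<subseteq> {1..n} \<and> no_square_product k A}"

end

theory Submission
  imports Defs "HOL-Real_Asymp.Real_Asymp"
begin

text \<open>Write a number of \<open>A\<close> as a product \<open>u * v\<close> and regard it as the edge \<open>(u, v)\<close> of a bipartite graph. The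
  product of the edges of a hexagon is a square, so the graph has no hexagon, and such a graph on \<open>U\<close>
  and \<open>V\<close> has \<open>O((|U||V|)\<^bsup>2/3\<^esup> + |U| + |V|)\<close> edges. Numbers with a prime factor \<open>p > n\<^bsup>2/3\<^esup>\<close> are treated as
  edges \<open>(a / p, p)\<close>; all but \<open>O(n\<^bsup>2/3\<^esup>)\<close> of them are accounted for by giving degree one to every prime and
  degree two to those up to \<open>n / 2\<close>. Every other number factors as \<open>u * v\<close> with
  \<open>u \<le> v\<^sup>2\<close>, \<open>v \<le> n\<^bsup>2/3\<^esup>\<close> and \<open>u\<close> having at least about twice as many prime factors as \<open>v\<close>. In each of the
  \<open>O(log n)\<close> dyadic ranges of \<open>v\<close>, split further into \<open>O(log log n)\<close> classes by the number of prime factors of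
  \<open>v\<close>, this imbalance gives \<open>|U||V| = O(n (log n) powr (z + 1 / z\<^sup>2 - 2))\<close> with \<open>z = 2\<^bsup>1/3\<^esup>\<close>, and
  \<open>1 + (2/3) (z + 1 / z\<^sup>2 - 2) = z - 1/3\<close>.\<close>

section \<open>Bipartite graphs without hexagons\<close>

definition hexagon_free :: "('a \<times> 'b) set \<Rightarrow> bool" where
  "hexagon_free E \<longleftrightarrow> \<not> (\<exists>x1 x2 x3 y1 y2 y3. distinct [x1, x2, x3] \<and> distinct [y1, y2, y3] \<and>
     {(x1, y1), (x2, y1), (x2, y2), (x3, y2), (x3, y3), (x1, y3)} \<subseteq> E)"

lemma hexagon_freeD:
  assumes "hexagon_free E" "distinct [x1, x2, x3]" "distinct [y1, y2, y3]"
    "(x1, y1) \<in> E" "(x2, y1) \<in> E" "(x2, y2) \<in> E" "(x3, y2) \<in> E" "(x3, y3) \<in> E" "(x1, y3) \<in> E"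
  shows False
  using assms unfolding hexagon_free_def by blast

text \<open>Each vertex of a hexagon lies on two of its edges, so the product of the six edge labels
  is the square of the product of the six vertices. Injectivity of the labelling on \<open>E\<close>
  makes the six labels distinct.\<close>

lemma hexagon_free_if_no_square_product:
  assumes "no_square_product 6 A" "(\<lambda>(u, v). u * v) ` E \<subseteq> A" "inj_on (\<lambda>(u, v). u * v) E"
  shows "hexagon_free E"
  unfolding hexagon_free_def
proof (rule notI, elim exE conjE)
  fix x1 x2 x3 y1 y2 y3 :: nat
  assume dx: "distinct [x1, x2, x3]" and dy: "distinct [y1, y2, y3]"
    and sub: "{(x1, y1), (x2, y1), (x2, y2), (x3, y2), (x3, y3), (x1, y3)} \<subseteq> E" (is "?H \<subseteq> E")
  let ?S = "(\<lambda>(u, v). u * v) ` ?H"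
  have inj: "inj_on (\<lambda>(u, v). u * v) ?H" by (rule inj_on_subset[OF assms(3) sub])
  have "card ?H = 6" using dx dy by auto
  then have "card ?S = 6" using card_image[OF inj] by simp
  moreover have "?S \<subseteq> A" using image_mono[OF sub] assms(2) by (rule order_trans)
  ultimately have "\<not> is_square (\<Prod>?S)" using assms(1) unfolding no_square_product_def by blast
  moreover have "\<Prod>?S = (\<Prod>(u, v)\<in>?H. u * v)"
    using prod.reindex[OF inj, of id] by (simp add: case_prod_unfold o_def)
  moreover have "(\<Prod>(u, v)\<in>?H. u * v) = (x1 * x2 * x3 * y1 * y2 * y3) ^ 2"
    using dx dy by (auto simp: power2_eq_square)
  ultimately show False by (metis is_nth_powerI)
qed

section \<open>Edge counts for hexagon-free graphs\<close>

lemma card_le_sum_fibres: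
  fixes E :: "('a \<times> 'b) set" assumes "finite Y" "snd ` E \<subseteq> Y" "finite E"
  shows "card E = (\<Sum>y\<in>Y. card {x. (x, y) \<in> E})"
proof -
  have "card E = (\<Sum>y\<in>Y. card {e\<in>E. snd e = y})"
    using sum.group[of E Y snd "\<lambda>_. 1 :: nat"] assms by simp
  also have "(\<Sum>y\<in>Y. card {e\<in>E. snd e = y}) = (\<Sum>y\<in>Y. card {x. (x, y) \<in> E})"
    by (rule sum.cong[OF refl], rule bij_betw_same_card[of fst]) (force simp: bij_betw_def inj_on_def)
  finally show ?thesis .
qed

text \<open>A zigzag is a path of four edges with both ends in \<open>Y\<close>. The
  \<open>x\<close> with at most two neighbours carry at most \<open>2 * card X\<close> edges. Of the
  other edges each \<open>y\<close> carries at most one, since two of them could be prolonged at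
  both ends to a zigzag.\<close>

lemma card_le_if_no_zigzag:
  assumes fin: "finite X" "finite Y" and sub: "E \<subseteq> Y \<times> X"
    and nozz: "\<And>y1 x1 y2 x2 y3. distinct [y1, y2, y3] \<Longrightarrow> x1 \<noteq> x2 \<Longrightarrow> (y1, x1) \<in> E \<Longrightarrow> (y2, x1) \<in> E \<Longrightarrow>
      (y2, x2) \<in> E \<Longrightarrow> (y3, x2) \<in> E \<Longrightarrow> False"
  shows "card E \<le> card Y + 2 * card X"
proof -
  define N where "N x = {y. (y, x) \<in> E}" for x
  have finE: "finite E" using sub fin finite_subset by blast
  have finN: "finite (N x)" for x
    unfolding N_def using fin sub by (auto intro: finite_subset[of _ Y])
  define S where "S = {e\<in>E. card (N (snd e)) \<le> 2}"
  define B where "B = {e\<in>E. card (N (snd e)) \<ge> 3}"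
  have "card S = (\<Sum>x\<in>X. card {y. (y, x) \<in> S})"
    by (rule card_le_sum_fibres) (use sub fin finE in \<open>auto simp: S_def\<close>)
  also have "\<dots> \<le> (\<Sum>x\<in>X. 2)"
  proof (rule sum_mono)
    fix x
    show "card {y. (y, x) \<in> S} \<le> 2"
    proof (cases "card (N x) \<le> 2")
      case True
      then have "{y. (y, x) \<in> S} = N x" by (auto simp: S_def N_def)
      then show ?thesis using True by simp
    next
      case False
      then have "{y. (y, x) \<in> S} = {}" by (auto simp: S_def N_def)
      then show ?thesis by simp
    qed
  qed
  finally have S: "card S \<le> 2 * card X" by simp
  have "inj_on fst B"
  proof (rule inj_onI, rule ccontr)
    fix e e' assume "e \<in> B" "e' \<in> B" "fst e = fst e'" "e \<noteq> e'"
    then obtain y x x' where e: "e = (y, x)" "e' = (y, x')" "x \<noteq> x'" by (metis prod.collapse)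
    have big: "(y, x) \<in> E" "(y, x') \<in> E" "card (N x) \<ge> 3" "card (N x') \<ge> 3"
      using \<open>e \<in> B\<close> \<open>e' \<in> B\<close> e by (auto simp: B_def)
    \<comment> \<open>Three neighbours leave one outside any two prescribed vertices, so the two
      ends can avoid \<open>y\<close> and each other.\<close>
    have pick: "\<exists>w\<in>N a. w \<noteq> b \<and> w \<noteq> c" if "card (N a) \<ge> 3" for a b c
    proof (rule ccontr)
      assume "\<not> ?thesis"
      then have "N a \<subseteq> {b, c}" by blast
      then have "card (N a) \<le> card {b, c}" by (simp add: card_mono)
      also have "\<dots> \<le> 2" by (simp add: card_insert_if)
      finally show False using that by simp
    qed
    obtain w where w: "w \<in> N x" "w \<noteq> y" using pick[OF big(3)] by blast
    obtain w' where w': "w' \<in> N x'" "w' \<noteq> y" "w' \<noteq> w" using pick[OF big(4)] by blast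
    show False using nozz[of w y w' x x'] w w' big e by (auto simp: N_def)
  qed
  then have "card B \<le> card Y"
    using sub fin by (intro card_inj_on_le[of fst]) (auto simp: B_def)
  moreover have "E = S \<union> B" by (auto simp: S_def B_def)
  ultimately show ?thesis using S card_Un_le[of S B] by simp
qed

text \<open>Among all pairs of vertex subsets take one maximizing the number of edges minus
  \<open>\<alpha>\<close> per left vertex and \<open>\<beta>\<close> per right vertex. Deleting a
  vertex cannot increase this, which is the degree condition. Density makes the maximum positive, so
  the left side is nonempty.\<close>

lemma ex_core_min_degree:
  fixes \<alpha> \<beta> :: real
  assumes fin: "finite U" "finite V" and sub: "E \<subseteq> U \<times> V"
    and nonneg: "\<beta> \<ge> 0" and dense: "\<alpha> * card U + \<beta> * card V < card E"
  obtains U' V' where "U' \<subseteq> U" "V' \<subseteq> V" "U' \<noteq> {}"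
    "\<And>u. u \<in> U' \<Longrightarrow> \<alpha> \<le> card {v\<in>V'. (u, v) \<in> E}" "\<And>v. v \<in> V' \<Longrightarrow> \<beta> \<le> card {u\<in>U'. (u, v) \<in> E}"
proof -
  define f where "f = (\<lambda>(A, B). real (card (E \<inter> A \<times> B)) - \<alpha> * card A - \<beta> * card B)"
  have "finite (Pow U \<times> Pow V)" "Pow U \<times> Pow V \<noteq> {}" using fin by auto
  then have "Max (f ` (Pow U \<times> Pow V)) \<in> f ` (Pow U \<times> Pow V)" by (intro Max_in) auto
  then obtain w where w: "w \<in> Pow U \<times> Pow V" "f w = Max (f ` (Pow U \<times> Pow V))" by auto
  obtain A B where AB: "w = (A, B)" "A \<subseteq> U" "B \<subseteq> V" using w(1) by auto
  have finA: "finite A" "finite B" using AB fin finite_subset by auto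
  have max: "f (A', B') \<le> f (A, B)" if "A' \<subseteq> U" "B' \<subseteq> V" for A' B'
    using w(2) AB that fin by (auto intro!: Max_ge)
  have finE: "finite (E \<inter> A \<times> B)" using finA by auto
  have "A \<noteq> {}"
  proof
    assume "A = {}"
    then have "f (A, B) \<le> 0" using nonneg by (auto simp: f_def)
    moreover have "f (U, V) > 0" using dense sub by (auto simp: f_def Int_absorb2)
    ultimately show False using max[of U V] by simp
  qed
  moreover have "\<alpha> \<le> card {v\<in>B. (u, v) \<in> E}" if "u \<in> A" for u
  proof -
    have "E \<inter> A \<times> B = (E \<inter> (A - {u}) \<times> B) \<union> Pair u ` {v\<in>B. (u, v) \<in> E}" using that by auto
    also have "card \<dots> = card (E \<inter> (A - {u}) \<times> B) + card (Pair u ` {v\<in>B. (u, v) \<in> E})"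
      using finA by (intro card_Un_disjoint) auto
    also have "card (Pair u ` {v\<in>B. (u, v) \<in> E}) = card {v\<in>B. (u, v) \<in> E}"
      by (intro card_image) (auto simp: inj_on_def)
    finally have "real (card (E \<inter> A \<times> B)) = card (E \<inter> (A - {u}) \<times> B) + card {v\<in>B. (u, v) \<in> E}" by simp
    moreover have "real (card A) = card (A - {u}) + 1"
      using card.remove[OF finA(1) that] by simp
    moreover have "f (A - {u}, B) \<le> f (A, B)" using max AB by blast
    ultimately show ?thesis by (simp add: f_def algebra_simps del: card_Diff_singleton card_Diff_insert)
  qed
  moreover have "\<beta> \<le> card {u\<in>A. (u, v) \<in> E}" if "v \<in> B" for v
  proof -
    have "E \<inter> A \<times> B = (E \<inter> A \<times> (B - {v})) \<union> (\<lambda>u. (u, v)) ` {u\<in>A. (u, v) \<in> E}" using that by auto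
    also have "card \<dots> = card (E \<inter> A \<times> (B - {v})) + card ((\<lambda>u. (u, v)) ` {u\<in>A. (u, v) \<in> E})"
      using finA by (intro card_Un_disjoint) auto
    also have "card ((\<lambda>u. (u, v)) ` {u\<in>A. (u, v) \<in> E}) = card {u\<in>A. (u, v) \<in> E}"
      by (intro card_image) (auto simp: inj_on_def)
    finally have "real (card (E \<inter> A \<times> B)) = card (E \<inter> A \<times> (B - {v})) + card {u\<in>A. (u, v) \<in> E}" by simp
    moreover have "real (card B) = card (B - {v}) + 1"
      using card.remove[OF finA(2) that] by simp
    moreover have "f (A, B - {v}) \<le> f (A, B)" using max AB by blast
    ultimately show ?thesis by (simp add: f_def algebra_simps del: card_Diff_singleton card_Diff_insert)
  qed
  ultimately show ?thesis using that AB by blast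
qed

lemma card_le_Suc_if_subset_insert:
  assumes "A \<subseteq> insert x B" "finite B" shows "card A \<le> Suc (card B)"
proof -
  have "card A \<le> card (insert x B)" using assms by (intro card_mono) auto
  also have "\<dots> \<le> Suc (card B)" using assms(2) by (simp add: card_insert_if)
  finally show ?thesis .
qed

text \<open>Explore the graph from some \<open>x\<close> up to distance three. Neither of the two outer layers of edges
  contains a zigzag, and the sets of vertices \<open>Ys y\<close> reached through different neighbours \<open>y\<close> of \<open>x\<close> are
  disjoint, because each violation closes up to a hexagon.\<close>

lemma hexagon_free_min_degree:
  fixes \<alpha> \<beta> :: real
  assumes hex: "hexagon_free E" and fin: "finite U" "finite V" "U \<noteq> {}"
    and dU: "\<And>u. u \<in> U \<Longrightarrow> \<alpha> \<le> card {v\<in>V. (u, v) \<in> E}"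
    and dV: "\<And>v. v \<in> V \<Longrightarrow> \<beta> \<le> card {u\<in>U. (u, v) \<in> E}"
    and ge4: "\<alpha> \<ge> 4" "\<beta> \<ge> 4"
  shows "\<alpha>\<^sup>2 * \<beta> \<le> 16 * card V"
proof -
  obtain x where x: "x \<in> U" using fin(3) by blast
  define Y where "Y = {v\<in>V. (x, v) \<in> E}"
  define X where "X = {u\<in>U. u \<noteq> x \<and> (\<exists>y\<in>Y. (u, y) \<in> E)}"
  have finXY: "finite X" "finite Y" using fin by (auto simp: X_def Y_def)
  have cY: "\<alpha> \<le> card Y" using dU[OF x] by (simp add: Y_def)
  have cX: "card Y * \<beta> / 4 \<le> card X"
  proof -
    define D where "D = {(y, u). y \<in> Y \<and> u \<in> X \<and> (u, y) \<in> E}"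
    have "card D \<le> card Y + 2 * card X"
    proof (rule card_le_if_no_zigzag)
      fix y1 x1 y2 x2 y3
      assume "distinct [y1, y2, y3]" "x1 \<noteq> x2" "(y1, x1) \<in> D" "(y2, x1) \<in> D" "(y2, x2) \<in> D" "(y3, x2) \<in> D"
      then show False
        by (intro hexagon_freeD[OF hex, of x x1 x2 y1 y2 y3]) (auto simp: D_def X_def Y_def)
    qed (use finXY in \<open>auto simp: D_def\<close>)
    \<comment> \<open>The loss of 1 is the root \<open>x\<close>, which is excluded from
      \<open>X\<close>.\<close>
    moreover have "card Y * (\<beta> - 1) \<le> card D"
    proof -
      have "D = (SIGMA y:Y. {u\<in>X. (u, y) \<in> E})" by (auto simp: D_def)
      then have "card D = (\<Sum>y\<in>Y. card {u\<in>X. (u, y) \<in> E})"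
        using finXY by (simp add: card_SigmaI)
      moreover have "(\<Sum>y\<in>Y. \<beta> - 1) \<le> (\<Sum>y\<in>Y. real (card {u\<in>X. (u, y) \<in> E}))"
      proof (rule sum_mono)
        fix y assume y: "y \<in> Y"
        then have "{u\<in>U. (u, y) \<in> E} \<subseteq> insert x {u\<in>X. (u, y) \<in> E}" by (auto simp: X_def)
        then have "card {u\<in>U. (u, y) \<in> E} \<le> Suc (card {u\<in>X. (u, y) \<in> E})"
          using finXY by (intro card_le_Suc_if_subset_insert) auto
        moreover have "\<beta> \<le> card {u\<in>U. (u, y) \<in> E}" using dV y by (auto simp: Y_def)
        ultimately show "\<beta> - 1 \<le> card {u\<in>X. (u, y) \<in> E}" by linarith
      qed
      ultimately show ?thesis by simp
    qed
    ultimately have "card Y * (\<beta> - 1) \<le> card Y + 2 * real (card X)" by linarith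
    \<comment> \<open>So far \<open>card X\<close> is at least
      \<open>card Y * (\<beta> - 2) / 2\<close>; the hypothesis \<open>\<beta> \<ge> 4\<close> turns
      this into \<open>card Y * \<beta> / 4\<close>.\<close>
    moreover have "real (card Y) * 4 \<le> card Y * \<beta>" using ge4 by (intro mult_left_mono) auto
    ultimately show ?thesis by (simp add: algebra_simps)
  qed
  have "\<forall>u\<in>X. \<exists>y\<in>Y. (u, y) \<in> E" by (auto simp: X_def)
  \<comment> \<open>A vertex of \<open>X\<close> may have several neighbours in \<open>Y\<close>;
    fixing one parent makes the classes \<open>Xs y\<close> a partition of \<open>X\<close>.\<close>
  then obtain par where par: "\<And>u. u \<in> X \<Longrightarrow> par u \<in> Y \<and> (u, par u) \<in> E" by metis
  define Xs where "Xs y = {u\<in>X. par u = y}" for y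
  define Ys where "Ys y = {v\<in>V. v \<noteq> y \<and> (\<exists>u\<in>Xs y. (u, v) \<in> E)}" for y
  have finXs: "finite (Xs y)" "finite (Ys y)" for y using fin finXY by (auto simp: Xs_def Ys_def)
  have XsE: "(u, y) \<in> E" if "u \<in> Xs y" for u y using par that by (auto simp: Xs_def)
  have cYs: "card (Xs y) * \<alpha> / 4 \<le> card (Ys y)" for y
  proof -
    define D where "D = {(u, v). u \<in> Xs y \<and> v \<in> Ys y \<and> (u, v) \<in> E}"
    have "card D \<le> card (Xs y) + 2 * card (Ys y)"
    proof (rule card_le_if_no_zigzag)
      fix y1 x1 y2 x2 y3
      assume "distinct [y1, y2, y3]" "x1 \<noteq> x2" "(y1, x1) \<in> D" "(y2, x1) \<in> D" "(y2, x2) \<in> D" "(y3, x2) \<in> D"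
      then show False
        by (intro hexagon_freeD[OF hex, of y1 y2 y3 x1 x2 y]) (auto simp: D_def Ys_def XsE)
    qed (use finXs in \<open>auto simp: D_def\<close>)
    moreover have "card (Xs y) * (\<alpha> - 1) \<le> card D"
    proof -
      have "D = (SIGMA u:Xs y. {v\<in>Ys y. (u, v) \<in> E})" by (auto simp: D_def)
      then have "card D = (\<Sum>u\<in>Xs y. card {v\<in>Ys y. (u, v) \<in> E})"
        using finXs by (simp add: card_SigmaI)
      moreover have "(\<Sum>u\<in>Xs y. \<alpha> - 1) \<le> (\<Sum>u\<in>Xs y. real (card {v\<in>Ys y. (u, v) \<in> E}))"
      proof (rule sum_mono)
        fix u assume u: "u \<in> Xs y"
        then have "{v\<in>V. (u, v) \<in> E} \<subseteq> insert y {v\<in>Ys y. (u, v) \<in> E}" by (auto simp: Ys_def)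
        then have "card {v\<in>V. (u, v) \<in> E} \<le> Suc (card {v\<in>Ys y. (u, v) \<in> E})"
          using finXs by (intro card_le_Suc_if_subset_insert) auto
        moreover have "\<alpha> \<le> card {v\<in>V. (u, v) \<in> E}" using dU u by (auto simp: Xs_def X_def)
        ultimately show "\<alpha> - 1 \<le> card {v\<in>Ys y. (u, v) \<in> E}" by linarith
      qed
      ultimately show ?thesis by simp
    qed
    ultimately have "card (Xs y) * (\<alpha> - 1) \<le> card (Xs y) + 2 * real (card (Ys y))" by linarith
    moreover have "real (card (Xs y)) * 4 \<le> card (Xs y) * \<alpha>" using ge4 by (intro mult_left_mono) auto
    ultimately show ?thesis by (simp add: algebra_simps)
  qed
  have disj: "Ys y \<inter> Ys y' = {}" if "y \<in> Y" "y' \<in> Y" "y \<noteq> y'" for y y'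
  proof (rule ccontr)
    assume "Ys y \<inter> Ys y' \<noteq> {}"
    then obtain w u u' where w: "w \<noteq> y" "w \<noteq> y'" "u \<in> Xs y" "u' \<in> Xs y'" "(u, w) \<in> E" "(u', w) \<in> E"
      unfolding Ys_def by blast
    then have "u \<noteq> u'" "u \<noteq> x" "u' \<noteq> x" using that(3) by (auto simp: Xs_def X_def)
    moreover have "(x, y) \<in> E" "(x, y') \<in> E" using that by (auto simp: Y_def)
    ultimately show False
      using hexagon_freeD[OF hex, of x u u' y w y'] w XsE that(3) by auto
  qed
  have "card X = (\<Sum>y\<in>Y. card (Xs y))"
    using sum.group[of X Y par "\<lambda>_. 1 :: nat"] finXY par by (simp add: Xs_def image_subset_iff)
  then have "card X * \<alpha> / 4 = (\<Sum>y\<in>Y. card (Xs y) * \<alpha> / 4)"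
    by (simp add: sum_distrib_right sum_divide_distrib)
  also have "\<dots> \<le> (\<Sum>y\<in>Y. real (card (Ys y)))" by (intro sum_mono cYs)
  also have "\<dots> = card (\<Union>y\<in>Y. Ys y)"
    using finXY finXs disj by (subst card_UN_disjoint) auto
  also have "\<dots> \<le> card V" using fin by (intro of_nat_mono card_mono) (auto simp: Ys_def)
  finally have 1: "card X * \<alpha> / 4 \<le> card V" .
  have "\<alpha> * \<beta> / 4 * \<alpha> / 4 \<le> card Y * \<beta> / 4 * \<alpha> / 4"
    using cY ge4 by (intro divide_right_mono mult_right_mono) auto
  also have "\<dots> \<le> card X * \<alpha> / 4"
    using cX ge4 by (intro divide_right_mono mult_right_mono) auto
  finally show ?thesis using 1 by (simp add: power2_eq_square algebra_simps)
qed

text \<open>With more edges there would be a core of minimum degrees \<open>\<alpha>\<close> and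
  \<open>\<beta>\<close>, against the degree bound. The values are chosen so that
  \<open>\<alpha>\<^sup>2 * \<beta>\<close> exceeds \<open>16 * card V\<close> while
  \<open>\<alpha> * card U\<close> and \<open>\<beta> * card V\<close> have the same main
  term.\<close>

lemma hexagon_free_card_le:
  assumes hex: "hexagon_free E" and fin: "finite U" "finite V" and sub: "E \<subseteq> U \<times> V"
  shows "real (card E) \<le> 4 * (real (card U) + real (card V)) + 6 * (real (card U) * real (card V)) powr (2/3)"
proof (cases "U = {} \<or> V = {}")
  case True
  then have "E = {}" using sub by auto
  then show ?thesis by simp
next
  case False
  define u v where "u = real (card U)" and "v = real (card V)"
  have uv: "u > 0" "v > 0" using False fin by (auto simp: u_def v_def card_gt_0_iff)
  \<comment> \<open>The factor 3 yields \<open>27 * v\<close>, which beats \<open>16 * v\<close>;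
    the summand 4 meets the hypotheses of the degree bound.\<close>
  define \<alpha> \<beta> where "\<alpha> = 4 + 3 * (v powr (2/3) / u powr (1/3))" and "\<beta> = 4 + 3 * (u powr (2/3) / v powr (1/3))"
  have ge: "\<alpha> \<ge> 4" "\<beta> \<ge> 4" by (auto simp: \<alpha>_def \<beta>_def)
  have "\<alpha>\<^sup>2 * \<beta> \<ge> (3 * (v powr (2/3) / u powr (1/3)))\<^sup>2 * (3 * (u powr (2/3) / v powr (1/3)))"
    unfolding \<alpha>_def \<beta>_def by (intro mult_mono power_mono) auto
  also have "(3 * (v powr (2/3) / u powr (1/3)))\<^sup>2 * (3 * (u powr (2/3) / v powr (1/3)))
      = 27 * (v powr (2/3) * v powr (2/3) * u powr (2/3)) / (u powr (1/3) * u powr (1/3) * v powr (1/3))"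
    by (simp add: power2_eq_square)
  also have "\<dots> = 27 * (v powr (4/3) / v powr (1/3))"
    using uv by (simp flip: powr_add)
  also have "v powr (4/3) / v powr (1/3) = v" using powr_diff[of v "4/3" "1/3"] uv by simp
  finally have "\<alpha>\<^sup>2 * \<beta> > 16 * v" using uv by simp
  have "card E \<le> \<alpha> * card U + \<beta> * card V"
  proof (rule ccontr)
    assume "\<not> ?thesis"
    then have "\<alpha> * card U + \<beta> * card V < card E" by simp
    then obtain U' V' where UV: "U' \<subseteq> U" "V' \<subseteq> V" "U' \<noteq> {}"
        "\<And>u. u \<in> U' \<Longrightarrow> \<alpha> \<le> card {v\<in>V'. (u, v) \<in> E}" "\<And>v. v \<in> V' \<Longrightarrow> \<beta> \<le> card {u\<in>U'. (u, v) \<in> E}"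
      using ex_core_min_degree[OF fin sub, of \<beta> \<alpha>] ge by auto
    have "\<alpha>\<^sup>2 * \<beta> \<le> 16 * card V'"
      by (rule hexagon_free_min_degree[OF hex finite_subset[OF UV(1) fin(1)] finite_subset[OF UV(2) fin(2)] UV(3-5) ge])
    also have "\<dots> \<le> 16 * v" using UV(2) fin by (simp add: v_def card_mono)
    finally show False using \<open>\<alpha>\<^sup>2 * \<beta> > 16 * v\<close> by simp
  qed
  also have "\<alpha> * card U + \<beta> * card V
      = 4 * (u + v) + 3 * (v powr (2/3) * (u powr 1 / u powr (1/3))) + 3 * (u powr (2/3) * (v powr 1 / v powr (1/3)))"
    using uv unfolding \<alpha>_def \<beta>_def u_def[symmetric] v_def[symmetric] by (simp add: algebra_simps)
  also have "u powr 1 / u powr (1/3) = u powr (2/3)" by (subst powr_diff[symmetric]) simp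
  also have "v powr 1 / v powr (1/3) = v powr (2/3)" by (subst powr_diff[symmetric]) simp
  finally show ?thesis using uv by (simp add: u_def v_def powr_mult)
qed

text \<open>A pair of vertices of \<open>U\<close> with at least three common neighbours is bad. Two bad pairs inside
  the neighbourhood of one \<open>v\<close> cannot share a vertex, since otherwise they close up to a hexagon
  through \<open>v\<close>. So a \<open>v\<close> of degree \<open>d\<close> sees at least \<open>d - 2\<close> good pairs at any fixed neighbour, while
  a good pair is seen at most twice.\<close>

lemma hexagon_free_sum_excess_degree:
  assumes hex: "hexagon_free E" and fin: "finite U" "finite V" and sub: "E \<subseteq> U \<times> V"
  shows "(\<Sum>v\<in>V. card {u. (u, v) \<in> E} - 2) \<le> 2 * (card U)\<^sup>2"
proof -
  define N where "N v = {u. (u, v) \<in> E}" for v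
  define C where "C a b = {v\<in>V. a \<in> N v \<and> b \<in> N v}" for a b
  define G where "G = {(a, b). a \<in> U \<and> b \<in> U \<and> a \<noteq> b \<and> card (C a b) \<le> 2}"
  have finN: "finite (N v)" and NU: "N v \<subseteq> U" for v
    using sub fin by (auto simp: N_def intro: finite_subset[of _ U])
  have finC: "finite (C a b)" for a b using fin by (simp add: C_def)
  have GU: "G \<subseteq> U \<times> U" by (auto simp: G_def)
  have finG: "finite G" using finite_subset[OF GU] fin by simp
  have main: "card (N v) - 2 \<le> card {g\<in>G. v \<in> C (fst g) (snd g)}" if v: "v \<in> V" for v
  proof (cases "N v = {}")
    case False
    then obtain a where a: "a \<in> N v" by blast
    define B where "B = {b \<in> N v. b \<noteq> a \<and> card (C a b) \<ge> 3}"
    have finB: "finite B" using finN by (simp add: B_def)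
    have pick: "\<exists>w\<in>C a b. w \<noteq> c \<and> w \<noteq> d" if "card (C a b) \<ge> 3" for b c d
    proof (rule ccontr)
      assume "\<not> ?thesis"
      then have "C a b \<subseteq> {c, d}" by blast
      then have "card (C a b) \<le> card {c, d}" by (simp add: card_mono)
      also have "\<dots> \<le> 2" by (simp add: card_insert_if)
      finally show False using that by simp
    qed
    have "b = b'" if b: "b \<in> B" "b' \<in> B" for b b'
    proof (rule ccontr)
      assume ne: "b \<noteq> b'"
      obtain w where w: "w \<in> C a b" "w \<noteq> v" using pick[of b v v] b by (auto simp: B_def)
      obtain w' where w': "w' \<in> C a b'" "w' \<noteq> v" "w' \<noteq> w" using pick[of b' v w] b by (auto simp: B_def)
      show False
        using ne w w' b v by (intro hexagon_freeD[OF hex, of b a b' w w' v]) (auto simp: B_def C_def N_def)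
    qed
    then have "card B \<le> 1" using finB by (metis card_le_Suc0_iff_eq One_nat_def)
    \<comment> \<open>One vertex is lost for \<open>a\<close> itself and at most one as a bad
      partner of \<open>a\<close>.\<close>
    have "card (N v) - 2 \<le> card (N v - {a} - B)"
    proof -
      have "card (N v) - card {a} \<le> card (N v - {a})" by (rule diff_card_le_card_Diff) simp
      moreover have "card (N v - {a}) - card B \<le> card (N v - {a} - B)" by (rule diff_card_le_card_Diff[OF finB])
      ultimately show ?thesis using \<open>card B \<le> 1\<close> by simp
    qed
    also have "\<dots> = card (Pair a ` (N v - {a} - B))" by (rule card_image[symmetric]) (auto simp: inj_on_def)
    also have "\<dots> \<le> card {g\<in>G. v \<in> C (fst g) (snd g)}"
      using finG a v NU[of v] by (intro card_mono) (auto simp: G_def B_def C_def)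
    finally show ?thesis .
  qed simp
  have "(\<Sum>v\<in>V. card (N v) - 2) \<le> (\<Sum>v\<in>V. card {g\<in>G. v \<in> C (fst g) (snd g)})"
    by (intro sum_mono main)
  also have "\<dots> = (\<Sum>g\<in>G. card {v\<in>V. v \<in> C (fst g) (snd g)})"
    using sum.swap_restrict[OF fin(2) finG, of "\<lambda>_ _. 1 :: nat" "\<lambda>v g. v \<in> C (fst g) (snd g)"] by simp
  also have "\<dots> \<le> (\<Sum>g\<in>G. 2)"
    by (intro sum_mono) (auto simp: G_def C_def)
  also have "\<dots> \<le> 2 * (card U)\<^sup>2"
    using card_mono[OF _ GU] fin by (simp add: card_cartesian_product power2_eq_square)
  finally show ?thesis by (simp add: N_def)
qed

section \<open>Sums over primes\<close>

lemma primes_upto_finite [simp]: "finite {p::nat. prime p \<and> p \<le> n}"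
  by (rule finite_subset[of _ "{..n}"]) auto

lemma primes_upto_Suc: "{p::nat. prime p \<and> p \<le> Suc n} =
    (if prime (Suc n) then insert (Suc n) {p. prime p \<and> p \<le> n} else {p. prime p \<and> p \<le> n})"
  by (auto simp: le_Suc_eq)

section \<open>Chebyshev's function and its linear upper bound\<close>

definition theta :: "nat \<Rightarrow> real" where
  "theta n = (\<Sum>p | prime p \<and> p \<le> n. ln (real p))"

lemma prod_primes_dvd:
  assumes "finite P" "\<And>p. p \<in> P \<Longrightarrow> prime p" "\<And>p. p \<in> P \<Longrightarrow> p dvd m"
  shows "\<Prod>P dvd (m::nat)"
  using assms
proof (induction P rule: finite_induct)
  case (insert p P)
  have "coprime p (\<Prod>P)" using insert by (intro prod_coprime_right) (metis insertCI primes_coprime)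
  then show ?case using insert by (simp add: divides_mult)
qed simp

lemma sum_ln_primes_le_ln:
  fixes m :: nat
  assumes "finite P" "\<And>p. p \<in> P \<Longrightarrow> prime p" "\<And>p. p \<in> P \<Longrightarrow> p dvd m" "m > 0"
  shows "(\<Sum>p\<in>P. ln (real p)) \<le> ln (real m)"
proof -
  have "(\<Sum>p\<in>P. ln (real p)) = ln (\<Prod>p\<in>P. real p)"
    using assms by (intro ln_prod[symmetric]) (auto dest: prime_gt_0_nat)
  also have "(\<Prod>p\<in>P. real p) = real (\<Prod>P)" by simp
  also have "ln (real (\<Prod>P)) \<le> ln (real m)"
  proof -
    have "\<Prod>P \<le> m" using prod_primes_dvd[OF assms(1-3)] assms(4) by (intro dvd_imp_le) auto
    moreover have "\<Prod>P > 0" using assms by (intro prod_pos) (auto dest: prime_gt_0_nat)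
    ultimately show ?thesis by (simp only: ln_le_cancel_iff of_nat_0_less_iff of_nat_le_iff assms(4))
  qed
  finally show ?thesis .
qed

text \<open>Such a prime divides \<open>fact (2 * m + 1)\<close> but is too large to divide
  \<open>fact m\<close> or \<open>fact (Suc m)\<close>.\<close>

lemma prime_dvd_central_choose:
  assumes p: "prime p" "m + 1 < p" "p \<le> 2 * m + 1"
  shows "p dvd ((2 * m + 1) choose m)"
proof -
  have "fact m * fact (Suc m) * ((2 * m + 1) choose m) = (fact (2 * m + 1) :: nat)"
    using binomial_fact_lemma[of m "2 * m + 1"] by simp
  moreover have "p dvd fact (2 * m + 1)" using p by (simp only: prime_dvd_fact_iff)
  ultimately have "p dvd fact m * fact (Suc m) * ((2 * m + 1) choose m)" by (simp only:)
  moreover have "\<not> p dvd fact m" "\<not> p dvd fact (Suc m)"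
    using p by (simp_all only: prime_dvd_fact_iff)
  ultimately show ?thesis using p(1) by (simp only: prime_dvd_mult_iff) blast
qed

text \<open>The two middle coefficients of an odd row are equal and together at most the row
  sum.\<close>

lemma central_choose_le: "((2 * m + 1) choose m) \<le> 4 ^ m"
proof -
  have "((2 * m + 1) choose m) + ((2 * m + 1) choose (m + 1)) = (\<Sum>k\<in>{m, m + 1}. (2 * m + 1) choose k)" by simp
  also have "\<dots> \<le> (\<Sum>k\<le>2 * m + 1. (2 * m + 1) choose k)" by (intro sum_mono2) auto
  also have "\<dots> = 2 ^ (2 * m + 1)" by (rule choose_row_sum)
  also have "((2 * m + 1) choose (m + 1)) = ((2 * m + 1) choose m)"
    by (subst binomial_symmetric) auto
  also have "(2::nat) ^ (2 * m + 1) = 2 * 4 ^ m" by (simp add: power_mult)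
  finally show ?thesis by simp
qed

text \<open>Erdos's induction: for \<open>n = 2 * m + 1\<close> the primes above
  \<open>m + 1\<close> divide a binomial coefficient of size at most \<open>4 ^ m\<close>, and those
  up to \<open>m + 1\<close> fall to the induction hypothesis. An even \<open>n > 2\<close> is not
  prime, so \<open>theta\<close> does not change there.\<close>

lemma theta_le: "theta n \<le> n * ln 4"
proof (induction n rule: less_induct)
  case (less n)
  consider "n = 0" | "n = 1" | "n = 2" | m where "n = 2 * m + 1" "m \<ge> 1" | m where "n = 2 * m" "m \<ge> 2"
  proof (cases "even n")
    case True
    then obtain m where "n = 2 * m" by blast
    then show ?thesis using that by (cases "m \<ge> 2") (auto simp: not_le less_Suc_eq numeral_2_eq_2)
  next
    case False
    then obtain m where "n = 2 * m + 1" by (blast elim: oddE)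
    then show ?thesis using that by (cases "m \<ge> 1") auto
  qed
  then show ?case
  proof cases
    case 1
    then have "{p. prime p \<and> p \<le> n} = {}" by (auto dest: prime_ge_2_nat)
    then have "theta n = 0" unfolding theta_def by (simp only: sum.empty)
    then show ?thesis by simp
  next
    case 2
    then have "{p. prime p \<and> p \<le> n} = {}" by (auto dest: prime_ge_2_nat)
    then have "theta n = 0" unfolding theta_def by (simp only: sum.empty)
    then show ?thesis by simp
  next
    case 3
    then have "{p. prime p \<and> p \<le> n} = {2}" by (auto dest: prime_ge_2_nat)
    then have "theta n = ln 2" unfolding theta_def by simp
    also have "\<dots> \<le> 2 * ln (4::real)" using ln_le_cancel_iff[of 2 4] ln_gt_zero[of 4] by linarith
    finally show ?thesis using 3 by simp
  next
    case (4 m)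
    let ?P = "{p. prime p \<and> m + 1 < p \<and> p \<le> 2 * m + 1}"
    have fin: "finite ?P" by (rule finite_subset[of _ "{..2*m+1}"]) auto
    have "{p. prime p \<and> p \<le> n} = {p. prime p \<and> p \<le> m + 1} \<union> ?P" using 4 by auto
    moreover have "(\<Sum>p\<in>{p. prime p \<and> p \<le> m + 1} \<union> ?P. ln (real p))
        = theta (m + 1) + (\<Sum>p\<in>?P. ln (real p))"
      unfolding theta_def using fin by (intro sum.union_disjoint) auto
    ultimately have "theta n = theta (m + 1) + (\<Sum>p\<in>?P. ln (real p))" by (simp only: theta_def)
    also have "theta (m + 1) \<le> (m + 1) * ln 4" using less[of "m + 1"] 4 by simp
    also have "(\<Sum>p\<in>?P. ln (real p)) \<le> ln (real ((2 * m + 1) choose m))"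
      using fin prime_dvd_central_choose[of _ m] by (intro sum_ln_primes_le_ln) auto
    also have "\<dots> \<le> ln (real (4 ^ m))"
      by (intro ln_mono of_nat_mono[OF central_choose_le]) simp
    also have "ln (real (4 ^ m)) = m * ln 4" by (simp add: ln_realpow)
    finally show ?thesis using 4 by (simp add: algebra_simps)
  next
    case (5 m)
    then obtain k where k: "n = Suc k" using not0_implies_Suc[of n] by auto
    have "\<not> prime n" using 5 prime_product[of 2 m] by auto
    then have "theta n = theta k" unfolding theta_def k by (subst primes_upto_Suc) (simp add: k)
    also have "\<dots> \<le> k * ln 4" using less[of k] k by simp
    also have "\<dots> \<le> n * ln 4" using k by simp
    finally show ?thesis .
  qed
qed

section \<open>Upper bounds of Mertens type\<close>

lemma card_multiples_upto:
  assumes "d > 0" shows "card {m\<in>{1..n}. d dvd m} = n div d"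
proof -
  have "{m\<in>{1..n}. d dvd m} = (\<lambda>k. d * k) ` {1..n div d}"
    using assms by (auto simp: image_iff dvd_def less_eq_div_iff_mult_less_eq mult.commute)
  then show ?thesis using assms by (simp add: card_image inj_on_def)
qed

definition mertens_sum :: "nat \<Rightarrow> real" where
  "mertens_sum n = (\<Sum>p | prime p \<and> p \<le> n. ln (real p) / p)"

text \<open>The sum of \<open>(n div p) * ln p\<close> counts \<open>ln p\<close> once for each
  multiple of \<open>p\<close> up to \<open>n\<close>. Grouped by multiples it is at most the sum of
  \<open>ln m\<close> for \<open>m \<le> n\<close>. Replacing \<open>n div p\<close> by
  \<open>n / p\<close> costs at most \<open>theta n\<close>.\<close>

lemma mertens_sum_le:
  assumes "n \<ge> 1" shows "mertens_sum n \<le> ln n + ln 4"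
proof -
  let ?P = "{p. prime p \<and> p \<le> n}"
  have "(\<Sum>p\<in>?P. (real n / p - 1) * ln (real p)) \<le> (\<Sum>p\<in>?P. real (n div p) * ln (real p))"
  proof (intro sum_mono mult_right_mono)
    fix p assume "p \<in> ?P"
    then have "real n / p < real (n div p) + 1"
      using dividend_less_div_times[of p n] prime_gt_0_nat[of p]
      by (simp add: divide_less_eq algebra_simps flip: of_nat_mult of_nat_add)
    then show "real n / p - 1 \<le> real (n div p)" by simp
  qed (auto dest: prime_ge_1_nat)
  also have "\<dots> = (\<Sum>p\<in>?P. \<Sum>m\<in>{m\<in>{1..n}. p dvd m}. ln (real p))"
    using card_multiples_upto[of _ n] by (intro sum.cong refl) (simp add: prime_gt_0_nat)
  also have "\<dots> = (\<Sum>m\<in>{1..n}. \<Sum>p\<in>{p\<in>?P. p dvd m}. ln (real p))"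
    by (rule sum.swap_restrict) auto
  also have "\<dots> \<le> (\<Sum>m\<in>{1..n}. ln (real n))"
  proof (rule sum_mono)
    fix m assume m: "m \<in> {1..n}"
    have "(\<Sum>p\<in>{p\<in>?P. p dvd m}. ln (real p)) \<le> ln (real m)"
      using m by (intro sum_ln_primes_le_ln) auto
    also have "\<dots> \<le> ln (real n)" using m by simp
    finally show "(\<Sum>p\<in>{p\<in>?P. p dvd m}. ln (real p)) \<le> ln (real n)" .
  qed
  finally have "(\<Sum>p\<in>?P. (real n / p - 1) * ln (real p)) \<le> n * ln n" by simp
  moreover have "(\<Sum>p\<in>?P. (real n / p - 1) * ln (real p)) = n * mertens_sum n - theta n"
    by (simp add: mertens_sum_def theta_def sum_subtractf sum_distrib_left algebra_simps)
  ultimately have "n * mertens_sum n \<le> n * (ln n + ln 4)"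
    using theta_le[of n] by (simp add: algebra_simps)
  then show ?thesis using assms by (simp add: mult_le_cancel_left)
qed

text \<open>Abel summation; the sum telescopes because
  \<open>ln N * (1 / ln N - 1 / ln (N + 1)) = 1 - ln N / ln (N + 1) \<le> ln (ln (N + 1) / ln N)\<close>.\<close>

lemma sum_inverse_primes_minus_mertens_sum_le:
  assumes "N \<ge> 2"
  shows "(\<Sum>p | prime p \<and> p \<le> N. 1 / real p) - mertens_sum N / ln N
    \<le> ln (ln N) - ln (ln 2) + ln 4 * (1 / ln 2 - 1 / ln N)"
  using assms
proof (induction N rule: dec_induct)
  case base
  have "{p::nat. prime p \<and> p \<le> 2} = {2}" by (auto dest: prime_ge_2_nat)
  then show ?case by (simp add: mertens_sum_def)
next
  case (step N)
  define S where "S N = (\<Sum>p | prime p \<and> p \<le> N. 1 / real p)" for N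
  have lnN: "ln (real N) > 0" "ln (real (Suc N)) > 0" using step.hyps by auto
  have le: "ln (real N) \<le> ln (real (Suc N))" using step.hyps by simp
  have "S (Suc N) - mertens_sum (Suc N) / ln (Suc N) = S N - mertens_sum N / ln (Suc N)"
  proof (cases "prime (Suc N)")
    case True
    have "mertens_sum (Suc N) / ln (Suc N) = mertens_sum N / ln (Suc N) + 1 / Suc N"
      using True lnN(2) unfolding mertens_sum_def primes_upto_Suc
      by (simp add: add_divide_distrib)
    moreover have "S (Suc N) = S N + 1 / Suc N"
      using True unfolding S_def primes_upto_Suc by simp
    ultimately show ?thesis by simp
  qed (simp add: S_def mertens_sum_def primes_upto_Suc)
  also have "\<dots> = (S N - mertens_sum N / ln N) + mertens_sum N * (1 / ln N - 1 / ln (Suc N))"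
    by (simp add: algebra_simps)
  also have "mertens_sum N * (1 / ln N - 1 / ln (Suc N)) \<le> (ln N + ln 4) * (1 / ln N - 1 / ln (Suc N))"
    using lnN le mertens_sum_le[of N] step.hyps by (intro mult_right_mono) (auto simp: frac_le)
  also have "\<dots> = (1 - ln N / ln (Suc N)) + ln 4 * (1 / ln N - 1 / ln (Suc N))"
    using lnN by (simp add: field_simps)
  also have "1 - ln N / ln (Suc N) \<le> ln (ln (Suc N)) - ln (ln N)"
    using ln_le_minus_one[of "ln N / ln (Suc N)"] lnN by (simp add: ln_div)
  finally show ?case using step.IH by (simp add: S_def algebra_simps)
qed

text \<open>The boundary term \<open>mertens_sum N / ln N\<close> is at most
  \<open>1 + ln 4 / ln N\<close>, and the second part cancels against the telescoped bound.\<close>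

lemma sum_inverse_primes_le:
  obtains C where "\<And>N. N \<ge> 2 \<Longrightarrow> (\<Sum>p | prime p \<and> p \<le> N. 1 / real p) \<le> ln (ln (real N)) + C"
proof
  fix N :: nat assume N: "N \<ge> 2"
  have lnN: "ln (real N) \<ge> ln 2" using N by simp
  have l2: "ln (2::real) > 0" by simp
  have pos: "ln (real N) > 0" using lnN l2 by linarith
  have "mertens_sum N / ln N \<le> (ln N + ln 4) / ln N"
    using mertens_sum_le[of N] pos N by (intro divide_right_mono) auto
  also have "\<dots> = 1 + ln 4 / ln N" using pos by (simp add: field_simps)
  finally show "(\<Sum>p | prime p \<and> p \<le> N. 1 / real p) \<le> ln (ln (real N)) + (1 - ln (ln 2) + ln 4 / ln 2)"
    using sum_inverse_primes_minus_mertens_sum_le[OF N] by (simp add: algebra_simps)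
qed

section \<open>Mean values of \<open>z\<close> to the number of prime factors\<close>

text \<open>The function usually called Omega: multiplicity is counted, so it is completely additive
  on positive integers.\<close>

definition bigomega :: "nat \<Rightarrow> nat" where
  "bigomega m = size (prime_factorization m)"

lemma bigomega_1 [simp]: "bigomega (Suc 0) = 0"
  by (simp add: bigomega_def)

lemma bigomega_mult: "a > 0 \<Longrightarrow> b > 0 \<Longrightarrow> bigomega (a * b) = bigomega a + bigomega b"
  by (simp add: bigomega_def prime_factorization_mult)

lemma bigomega_prime: "prime p \<Longrightarrow> bigomega p = 1"
  by (simp add: bigomega_def prime_factorization_prime)

lemma bigomega_prime_power: "prime p \<Longrightarrow> bigomega (p ^ k) = k"
  by (induction k) (auto simp: bigomega_mult bigomega_prime prime_gt_0_nat)

lemma sum_power_le_geometric: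
  fixes r :: real assumes "0 \<le> r" "r < 1" shows "(\<Sum>k=a..b. r ^ k) \<le> r ^ a / (1 - r)"
proof (cases "a \<le> b")
  case True
  have "(1 - r) * (\<Sum>k=a..b. r ^ k) = r ^ a - r ^ Suc b" by (rule sum_gp_multiplied[OF True])
  also have "\<dots> \<le> r ^ a" using assms by simp
  finally show ?thesis using assms by (simp add: pos_le_divide_eq mult.commute)
qed (use assms in simp)

text \<open>Splitting off the exact power of one prime \<open>p\<close> factors the weight, and the
  powers of \<open>p\<close> form a geometric series of ratio \<open>z / p\<close>. The prime 2 is
  the reason for \<open>z < 2\<close>.\<close>

lemma sum_over_smooth_le_euler_product:
  fixes z :: real
  assumes "finite P" "\<And>p. p \<in> P \<Longrightarrow> prime p" "0 \<le> z" "z < 2" "finite M" "0 \<notin> M"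
    "\<And>m. m \<in> M \<Longrightarrow> prime_factors m \<subseteq> P"
  shows "(\<Sum>m\<in>M. z ^ bigomega m / real m) \<le> (\<Prod>p\<in>P. 1 / (1 - z / real p))"
  using assms
proof (induction P arbitrary: M rule: finite_induct)
  case empty
  have "m = 1" if "m \<in> M" for m
  proof -
    have "prime_factors m = {}" using empty.prems(6)[OF that] by simp
    moreover have "m \<noteq> 0" using empty.prems(5) that by metis
    ultimately have "prime_factorization m = {#}" "m \<noteq> 0" by auto
    then show ?thesis using prime_factorization_empty_iff[of m] by auto
  qed
  then have "M \<subseteq> {1}" by blast
  then have "M = {} \<or> M = {1}" by blast
  then show ?case by auto
next
  case (insert p P)
  have p: "prime p" "p \<ge> 2" using insert.prems(1)[of p] prime_ge_2_nat by auto
  define r where "r = z / real p"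
  have "z / p \<le> z / 2" using p insert.prems by (intro divide_left_mono) auto
  then have "z / p < 1" using insert.prems(3) by linarith
  then have r: "0 \<le> r" "r < 1" using insert.prems(2) by (auto simp: r_def)
  define v where "v m = multiplicity p m" for m
  define \<phi> where "\<phi> m = (v m, m div p ^ v m)" for m
  define M' where "M' = (\<lambda>m. m div p ^ v m) ` M"
  define h where "h = (\<lambda>(k, m). r ^ k * (z ^ bigomega m / real m))"
  have dec: "m = p ^ v m * (m div p ^ v m)" for m
    by (simp add: v_def multiplicity_dvd)
  have inj: "inj_on \<phi> M"
    by (rule inj_onI) (metis Pair_inject \<phi>_def dec)
  have pos: "m div p ^ v m > 0" if "m \<in> M" for m
    using dec[of m] insert.prems(5) that by (metis gr0I mult_0_right)
  have h: "z ^ bigomega m / real m = h (\<phi> m)" if "m \<in> M" for m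
  proof -
    let ?m = "m div p ^ v m"
    have "bigomega m = v m + bigomega ?m"
      using dec[of m] pos[OF that] p bigomega_mult[of "p ^ v m" ?m] by (simp add: bigomega_prime_power)
    moreover have "real m = real p ^ v m * real ?m" using dec[of m] by (metis of_nat_mult of_nat_power)
    ultimately show ?thesis
      by (simp add: h_def \<phi>_def r_def power_add power_divide)
  qed
  have hnn: "h q \<ge> 0" for q using r insert.prems by (auto simp: h_def case_prod_unfold)
  have finM: "finite M" "finite M'" using insert.prems by (auto simp: M'_def)
  have "(\<Sum>m\<in>M. z ^ bigomega m / real m) = (\<Sum>m\<in>M. h (\<phi> m))"
    by (rule sum.cong[OF refl h])
  also have "\<dots> = (\<Sum>q\<in>\<phi> ` M. h q)" using sum.reindex[OF inj, of h] by simp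
  \<comment> \<open>The image of \<open>M\<close> need not be a product set; enlarging it to one
    only adds nonnegative terms and lets the sum factor.\<close>
  also have "\<dots> \<le> (\<Sum>q\<in>{0..Max (v ` M)} \<times> M'. h q)"
    using finM hnn by (intro sum_mono2) (auto simp: \<phi>_def M'_def)
  also have "\<dots> = (\<Sum>k=0..Max (v ` M). r ^ k) * (\<Sum>m\<in>M'. z ^ bigomega m / real m)"
    unfolding h_def sum_product by (simp add: sum.cartesian_product)
  also have "\<dots> \<le> 1 / (1 - r) * (\<Prod>p\<in>P. 1 / (1 - z / real p))"
  proof (rule mult_mono)
    show "(\<Sum>k=0..Max (v ` M). r ^ k) \<le> 1 / (1 - r)" using sum_power_le_geometric[OF r, of 0] by simp
    show "(\<Sum>m\<in>M'. z ^ bigomega m / real m) \<le> (\<Prod>p\<in>P. 1 / (1 - z / real p))"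
    proof (rule insert.IH)
      show "0 \<notin> M'"
      proof
        assume "0 \<in> M'"
        then obtain m where "m \<in> M" "m div p ^ v m = 0" by (auto simp: M'_def)
        then show False using pos[of m] by simp
      qed
      fix m assume "m \<in> M'"
      then obtain l where l: "l \<in> M" "m = l div p ^ v l" by (auto simp: M'_def)
      have l0: "l \<noteq> 0" using l insert.prems by metis
      have "\<not> p dvd m" unfolding l v_def
        using l0 p by (intro multiplicity_decompose) auto
      moreover have "m dvd l" using dec[of l] l by (metis dvd_triv_right)
      then have "prime_factors m \<subseteq> prime_factors l" using l0 by (intro dvd_prime_factors) auto
      ultimately show "prime_factors m \<subseteq> P"
        using insert.prems(6)[OF l(1)] by (auto dest: in_prime_factors_imp_dvd)
    qed (use insert.prems finM in auto)
  qed (use r insert.prems in \<open>auto intro!: sum_nonneg\<close>)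
  also have "\<dots> = (\<Prod>p\<in>insert p P. 1 / (1 - z / real p))"
    using insert.hyps by (simp add: r_def)
  finally show ?case .
qed

lemma inverse_one_minus_le_exp:
  fixes y :: real assumes "0 \<le> y" "y \<le> c" "c < 1"
  shows "1 / (1 - y) \<le> exp (y + y\<^sup>2 / (1 - c))"
proof -
  have "1 / (1 - y) = 1 + (y + y\<^sup>2 / (1 - y))"
    using assms by (simp add: field_simps power2_eq_square)
  also have "\<dots> \<le> exp (y + y\<^sup>2 / (1 - y))" by (rule exp_ge_add_one_self)
  also have "y\<^sup>2 / (1 - y) \<le> y\<^sup>2 / (1 - c)" using assms by (intro divide_left_mono) auto
  then have "exp (y + y\<^sup>2 / (1 - y)) \<le> exp (y + y\<^sup>2 / (1 - c))" by simp
  finally show ?thesis .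
qed

text \<open>In the exponent the first-order terms sum to \<open>z\<close> times the sum of
  \<open>1 / p\<close>, which gives the power of \<open>ln N\<close>. The second-order terms are
  dominated by the convergent series of inverse squares, uniformly since
  \<open>z / p \<le> z / 2 < 1\<close>.\<close>

lemma euler_product_le:
  fixes z :: real assumes z: "0 < z" "z < 2"
  obtains C where "C > 0"
    "\<And>N. N \<ge> 2 \<Longrightarrow> (\<Prod>p | prime p \<and> p \<le> N. 1 / (1 - z / real p)) \<le> C * ln (real N) powr z"
proof -
  obtain c where c: "\<And>N. N \<ge> 2 \<Longrightarrow> (\<Sum>p | prime p \<and> p \<le> N. 1 / real p) \<le> ln (ln (real N)) + c"
    using sum_inverse_primes_le by blast
  define B where "B = (\<Sum>n. inverse (real n ^ 2))"
  have B: "(\<Sum>p | prime p \<and> p \<le> N. inverse (real p ^ 2)) \<le> B" for N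
    unfolding B_def by (rule sum_le_suminf) (auto intro: inverse_power_summable)
  define C where "C = exp (z * c + z\<^sup>2 / (1 - z/2) * B)"
  show ?thesis
  proof
    show "C > 0" by (simp add: C_def)
    fix N :: nat assume N: "N \<ge> 2"
    let ?P = "{p. prime p \<and> p \<le> N}"
    have "(\<Prod>p\<in>?P. 1 / (1 - z / real p)) \<le> (\<Prod>p\<in>?P. exp (z * (1 / p) + z\<^sup>2 / (1 - z/2) * inverse (real p ^ 2)))"
    proof (rule prod_mono)
      fix p assume "p \<in> ?P"
      then have "p \<ge> 2" by (auto dest: prime_ge_2_nat)
      then have "z / p \<le> z / 2" using z by (intro divide_left_mono) auto
      moreover have "0 \<le> z / p" "z / 2 < 1" using z by auto
      ultimately have "1 - z / p \<ge> 0" "1 / (1 - z / p) \<le> exp (z / p + (z / p)\<^sup>2 / (1 - z/2))"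
        using inverse_one_minus_le_exp[of "z / p" "z / 2"] by linarith+
      moreover have "z / p + (z / p)\<^sup>2 / (1 - z/2) = z * (1 / p) + z\<^sup>2 / (1 - z/2) * inverse (real p ^ 2)"
        by (simp add: power_divide inverse_eq_divide mult.commute)
      ultimately show "0 \<le> 1 / (1 - z / real p) \<and>
          1 / (1 - z / real p) \<le> exp (z * (1 / p) + z\<^sup>2 / (1 - z/2) * inverse (real p ^ 2))"
        by (simp only: divide_nonneg_nonneg zero_le_one)
    qed
    also have "\<dots> = exp (z * (\<Sum>p\<in>?P. 1 / real p) + z\<^sup>2 / (1 - z/2) * (\<Sum>p\<in>?P. inverse (real p ^ 2)))"
      by (simp add: exp_sum[symmetric] sum.distrib sum_distrib_left)
    also have "\<dots> \<le> exp (z * (ln (ln (real N)) + c) + z\<^sup>2 / (1 - z/2) * B)"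
      using c[OF N] B[of N] z by (intro exp_le_cancel_iff[THEN iffD2] add_mono mult_left_mono) auto
    also have "\<dots> = C * ln (real N) powr z"
      using N by (simp add: C_def powr_def exp_add[symmetric] algebra_simps)
    finally show "(\<Prod>p\<in>?P. 1 / (1 - z / real p)) \<le> C * ln (real N) powr z" .
  qed
qed

lemma sum_power_bigomega_over_le:
  fixes z :: real assumes z: "0 < z" "z < 2"
  obtains C where "C > 0" "\<And>N. N \<ge> 2 \<Longrightarrow> (\<Sum>m=1..N. z ^ bigomega m / real m) \<le> C * ln (real N) powr z"
proof -
  obtain C where C: "C > 0"
    "\<And>N. N \<ge> 2 \<Longrightarrow> (\<Prod>p | prime p \<and> p \<le> N. 1 / (1 - z / real p)) \<le> C * ln (real N) powr z"
    using euler_product_le[OF z] by blast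
  have "(\<Sum>m=1..N. z ^ bigomega m / real m) \<le> (\<Prod>p | prime p \<and> p \<le> N. 1 / (1 - z / real p))" for N
    using z by (intro sum_over_smooth_le_euler_product)
      (auto simp: prime_factors_dvd dest: dvd_imp_le)
  then show ?thesis using C that by (meson order_trans)
qed

section \<open>From the logarithmic mean to the ordinary mean\<close>

definition prime_power_pairs :: "nat \<Rightarrow> (nat \<times> nat) set" where
  "prime_power_pairs y = {(p, k). prime p \<and> 1 \<le> k \<and> p ^ k \<le> y}"

lemma prime_power_pairs_Sigma:
  "prime_power_pairs y = (SIGMA p:{p. prime p \<and> p \<le> y}. {k\<in>{1..y}. p ^ k \<le> y})"
proof -
  have "p \<le> y \<and> k \<le> y" if "prime p" "1 \<le> k" "p ^ k \<le> y" for p k :: nat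
  proof -
    have p: "p \<ge> 2" using that prime_ge_2_nat by blast
    have "p ^ 1 \<le> p ^ k" using that p by (intro power_increasing) auto
    moreover have "k < p ^ k" using p by (intro power_gt_expt) simp
    ultimately show ?thesis using that by simp
  qed
  then show ?thesis by (auto simp: prime_power_pairs_def)
qed

lemma finite_prime_power_pairs [simp]: "finite (prime_power_pairs y)"
  unfolding prime_power_pairs_Sigma by (intro finite_SigmaI) auto

text \<open>This is the von Mangoldt identity: each prime \<open>p\<close> contributes
  \<open>ln p\<close> once for every exponent up to its multiplicity. The common bound
  \<open>N\<close> gives all \<open>m\<close> the same index set, ready for interchanging
  sums.\<close>

lemma ln_eq_sum_prime_power_pairs:
  assumes m: "1 \<le> m" "m \<le> N"
  shows "ln (real m) = (\<Sum>q\<in>{q\<in>prime_power_pairs N. fst q ^ snd q dvd m}. ln (real (fst q)))"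
proof -
  have "{q\<in>prime_power_pairs N. fst q ^ snd q dvd m} = (SIGMA p:prime_factors m. {1..multiplicity p m})"
  proof (intro set_eqI iffI)
    fix q assume "q \<in> {q\<in>prime_power_pairs N. fst q ^ snd q dvd m}"
    then obtain p k where q: "q = (p, k)" "prime p" "1 \<le> k" "p ^ k dvd m"
      by (auto simp: prime_power_pairs_def)
    have "k \<le> multiplicity p m" using q m by (intro multiplicity_geI) auto
    moreover have "p dvd m" using q dvd_trans[OF dvd_power[of k p]] by auto
    ultimately show "q \<in> (SIGMA p:prime_factors m. {1..multiplicity p m})"
      using q m by (auto simp: prime_factors_dvd)
  next
    fix q assume "q \<in> (SIGMA p:prime_factors m. {1..multiplicity p m})"
    then obtain p k where q: "q = (p, k)" "prime p" "1 \<le> k" "k \<le> multiplicity p m"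
      by (auto simp: in_prime_factors_iff)
    then have "p ^ k dvd m" by (intro multiplicity_dvd')
    then have "p ^ k \<le> N" using m dvd_imp_le[of "p ^ k" m] by linarith
    then show "q \<in> {q\<in>prime_power_pairs N. fst q ^ snd q dvd m}"
      using q \<open>p ^ k dvd m\<close> by (auto simp: prime_power_pairs_def)
  qed
  then have "(\<Sum>q\<in>{q\<in>prime_power_pairs N. fst q ^ snd q dvd m}. ln (real (fst q)))
      = (\<Sum>p\<in>prime_factors m. \<Sum>k=1..multiplicity p m. ln (real p))"
    by (subst sum.Sigma) (simp_all add: case_prod_unfold)
  also have "\<dots> = (\<Sum>p\<in>prime_factors m. ln (real p ^ multiplicity p m))"
    by (intro sum.cong refl) (auto simp: ln_realpow in_prime_factors_iff prime_gt_0_nat)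
  also have "\<dots> = ln (\<Prod>p\<in>prime_factors m. real p ^ multiplicity p m)"
    by (intro ln_prod[symmetric]) (auto simp: in_prime_factors_iff prime_gt_0_nat)
  also have "(\<Prod>p\<in>prime_factors m. real p ^ multiplicity p m) = real (\<Prod>p\<in>prime_factors m. p ^ multiplicity p m)"
    by simp
  also have "(\<Prod>p\<in>prime_factors m. p ^ multiplicity p m) = m"
    using m prime_factorization_nat[of m] by simp
  finally show ?thesis by simp
qed

text \<open>A weighted Chebyshev bound. Exponent 1 contributes \<open>z * theta y\<close>. For
  \<open>k \<ge> 2\<close> the condition \<open>p ^ k \<le> y\<close> gives
  \<open>z ^ k \<le> y * (z / p) ^ k\<close>, a geometric series of size
  \<open>O(y / p\<^sup>2)\<close>, and the sum of \<open>ln p / p\<^sup>2\<close> converges.\<close>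

lemma sum_prime_power_pairs_le:
  fixes z :: real assumes z: "0 < z" "z < 2"
  obtains C where "C > 0" "\<And>y. (\<Sum>q\<in>prime_power_pairs y. z ^ snd q * ln (real (fst q))) \<le> C * real y"
proof -
  define B where "B = (\<Sum>n. 2 * real n powr (-3/2))"
  have sm: "summable (\<lambda>n. 2 * real n powr (-3/2))"
    by (intro summable_mult) (simp add: summable_real_powr_iff)
  have B: "(\<Sum>p | prime p \<and> p \<le> y. ln (real p) / real p ^ 2) \<le> B" for y
  proof -
    have "(\<Sum>p | prime p \<and> p \<le> y. ln (real p) / real p ^ 2) \<le> (\<Sum>p | prime p \<and> p \<le> y. 2 * real p powr (-3/2))"
    proof (rule sum_mono)
      fix p assume "p \<in> {p. prime p \<and> p \<le> y}"
      then have p: "real p \<ge> 1" by (auto dest: prime_ge_1_nat)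
      have "ln (real p) \<le> 2 * real p powr (1/2)" using ln_powr_bound[OF p, of "1/2"] by simp
      then have "ln (real p) / real p ^ 2 \<le> 2 * (real p powr (1/2) / real p powr 2)"
        using p by (simp add: divide_right_mono)
      also have "real p powr (1/2) / real p powr 2 = real p powr (-3/2)"
        by (subst powr_diff[symmetric]) simp
      finally show "ln (real p) / real p ^ 2 \<le> 2 * real p powr (-3/2)" .
    qed
    also have "\<dots> \<le> B" unfolding B_def using sm by (intro sum_le_suminf) auto
    finally show ?thesis .
  qed
  have "B \<ge> 0" unfolding B_def using sm by (intro suminf_nonneg) auto
  define D where "D = z\<^sup>2 / (1 - z/2)"
  have D: "D > 0" using z by (simp add: D_def)
  show ?thesis
  proof
    show "z * ln 4 + D * B > 0" using z D \<open>B \<ge> 0\<close> by (intro add_pos_nonneg) auto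
    fix y :: nat
    let ?P = "{p. prime p \<and> p \<le> y}"
    have inner: "(\<Sum>k\<in>{k\<in>{1..y}. p ^ k \<le> y}. z ^ k) \<le> z + D * real y / real p ^ 2" if "p \<in> ?P" for p
    proof -
      have p: "p \<ge> 2" using that by (auto dest: prime_ge_2_nat)
      have zp: "z / p \<le> z / 2" using z p by (intro divide_left_mono) auto
      then have zp1: "z / p < 1" using z by linarith
      have "(\<Sum>k\<in>{k\<in>{1..y}. p ^ k \<le> y}. z ^ k) \<le> (\<Sum>k\<in>insert 1 {k\<in>{2..y}. p ^ k \<le> y}. z ^ k)"
        using z by (intro sum_mono2) auto
      also have "\<dots> = z + (\<Sum>k\<in>{k\<in>{2..y}. p ^ k \<le> y}. z ^ k)" by simp
      also have "(\<Sum>k\<in>{k\<in>{2..y}. p ^ k \<le> y}. z ^ k) \<le> (\<Sum>k\<in>{k\<in>{2..y}. p ^ k \<le> y}. real y * (z / p) ^ k)"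
      proof (rule sum_mono)
        fix k assume "k \<in> {k\<in>{2..y}. p ^ k \<le> y}"
        then have "real p ^ k \<le> real y" by (simp flip: of_nat_power)
        then have "z ^ k * real p ^ k \<le> z ^ k * real y" using z by (intro mult_left_mono) auto
        then show "z ^ k \<le> real y * (z / p) ^ k" using p by (simp add: power_divide field_simps)
      qed
      also have "\<dots> \<le> (\<Sum>k=2..y. real y * (z / p) ^ k)" using z by (intro sum_mono2) auto
      also have "\<dots> = real y * (\<Sum>k=2..y. (z / p) ^ k)" by (simp add: sum_distrib_left)
      also have "\<dots> \<le> real y * ((z / p) ^ 2 / (1 - z / p))"
        using z zp1 by (intro mult_left_mono sum_power_le_geometric) (simp_all only: of_nat_0_le_iff, simp)
      also have "\<dots> \<le> real y * ((z / p) ^ 2 / (1 - z / 2))"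
        using z zp zp1 by (intro mult_left_mono divide_left_mono mult_pos_pos) auto
      finally show ?thesis by (simp add: D_def power_divide field_simps)
    qed
    have "(\<Sum>q\<in>prime_power_pairs y. z ^ snd q * ln (real (fst q)))
        = (\<Sum>p\<in>?P. \<Sum>k\<in>{k\<in>{1..y}. p ^ k \<le> y}. z ^ k * ln (real p))"
      unfolding prime_power_pairs_Sigma by (subst sum.Sigma) (auto simp: case_prod_unfold)
    also have "\<dots> = (\<Sum>p\<in>?P. (\<Sum>k\<in>{k\<in>{1..y}. p ^ k \<le> y}. z ^ k) * ln (real p))"
      by (simp add: sum_distrib_right)
    also have "\<dots> \<le> (\<Sum>p\<in>?P. (z + D * real y / real p ^ 2) * ln (real p))"
      by (intro sum_mono mult_right_mono inner) (auto dest: prime_ge_1_nat)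
    also have "\<dots> = z * theta y + D * real y * (\<Sum>p\<in>?P. ln (real p) / real p ^ 2)"
      by (simp add: theta_def sum_distrib_left sum.distrib algebra_simps)
    also have "\<dots> \<le> z * (y * ln 4) + D * real y * B"
      using z D theta_le[of y] B[of y] by (intro add_mono mult_left_mono) auto
    finally show "(\<Sum>q\<in>prime_power_pairs y. z ^ snd q * ln (real (fst q))) \<le> (z * ln 4 + D * B) * real y"
      by (simp add: algebra_simps)
  qed
qed

text \<open>Weighting by \<open>ln m\<close> and expanding \<open>ln m\<close> over the prime powers dividing \<open>m\<close> gains the factor
  \<open>ln N\<close> over the logarithmic mean (the Hall--Tenenbaum argument).\<close>

lemma sum_power_bigomega_le:
  fixes z :: real assumes z: "0 < z" "z < 2"
  obtains C where "C > 0" "\<And>N. N \<ge> 2 \<Longrightarrow> (\<Sum>m=1..N. z ^ bigomega m) \<le> C * real N * ln (real N) powr (z - 1)"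
proof -
  obtain A where A: "A > 0" "\<And>N. N \<ge> 2 \<Longrightarrow> (\<Sum>m=1..N. z ^ bigomega m / real m) \<le> A * ln (real N) powr z"
    using sum_power_bigomega_over_le[OF z] by blast
  obtain B where B: "B > 0" "\<And>y. (\<Sum>q\<in>prime_power_pairs y. z ^ snd q * ln (real (fst q))) \<le> B * real y"
    using sum_prime_power_pairs_le[OF z] by blast
  show ?thesis
  proof
    show "(B + 1) * A > 0" using A B by simp
    fix N :: nat assume N: "N \<ge> 2"
    let ?f = "\<lambda>m. z ^ bigomega m"
    let ?L = "\<Sum>m=1..N. ?f m / real m"
    let ?Q = "prime_power_pairs N"
    have "(\<Sum>m=1..N. ?f m * ln (real m))
        = (\<Sum>m=1..N. \<Sum>q\<in>{q\<in>?Q. fst q ^ snd q dvd m}. ?f m * ln (real (fst q)))"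
    proof (intro sum.cong refl)
      fix m assume "m \<in> {1..N}"
      then show "?f m * ln (real m) = (\<Sum>q\<in>{q\<in>?Q. fst q ^ snd q dvd m}. ?f m * ln (real (fst q)))"
        using ln_eq_sum_prime_power_pairs[of m N] by (simp only: atLeastAtMost_iff sum_distrib_left)
    qed
    also have "\<dots> = (\<Sum>q\<in>?Q. \<Sum>m\<in>{m\<in>{1..N}. fst q ^ snd q dvd m}. ?f m * ln (real (fst q)))"
      by (rule sum.swap_restrict) auto
    \<comment> \<open>Substitute \<open>m = p ^ k * j\<close>; by complete additivity the weight
      splits off \<open>z ^ k\<close> even when \<open>p\<close> divides \<open>j\<close>.\<close>
    also have "\<dots> = (\<Sum>q\<in>?Q. \<Sum>j\<in>{j\<in>{1..N}. fst q ^ snd q * j \<le> N}. ?f j * (z ^ snd q * ln (real (fst q))))"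
    proof (rule sum.cong[OF refl])
      fix q assume "q \<in> ?Q"
      then obtain p k where q: "q = (p, k)" "prime p" "1 \<le> k" by (auto simp: prime_power_pairs_def)
      have pk: "p ^ k > 0" using q by (simp add: prime_gt_0_nat)
      have "{m\<in>{1..N}. p ^ k dvd m} = (\<lambda>j. p ^ k * j) ` {j\<in>{1..N}. p ^ k * j \<le> N}"
      proof (intro set_eqI iffI)
        fix m assume m: "m \<in> {m\<in>{1..N}. p ^ k dvd m}"
        then obtain j where j: "m = p ^ k * j" by (auto elim: dvdE)
        then have "j \<ge> 1" using m by (cases "j = 0") auto
        moreover have "j \<le> p ^ k * j" using mult_le_mono1[of 1 "p ^ k" j] pk by linarith
        moreover have "p ^ k * j \<le> N" using m j by simp
        moreover from calculation have "j \<le> N" by linarith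
        ultimately have "j \<in> {j\<in>{1..N}. p ^ k * j \<le> N}" by simp
        then show "m \<in> (\<lambda>j. p ^ k * j) ` {j\<in>{1..N}. p ^ k * j \<le> N}" using j by blast
      next
        fix m assume "m \<in> (\<lambda>j. p ^ k * j) ` {j\<in>{1..N}. p ^ k * j \<le> N}"
        then obtain j where "m = p ^ k * j" "j \<ge> 1" "p ^ k * j \<le> N" by auto
        moreover have "1 * 1 \<le> p ^ k * j" using pk \<open>j \<ge> 1\<close> by (intro mult_le_mono) linarith+
        ultimately show "m \<in> {m\<in>{1..N}. p ^ k dvd m}" by simp
      qed
      moreover have "inj_on (\<lambda>j. p ^ k * j) {j\<in>{1..N}. p ^ k * j \<le> N}"
        using pk by (intro inj_onI) (metis mult_left_cancel not_gr0)
      ultimately have "(\<Sum>m\<in>{m\<in>{1..N}. p ^ k dvd m}. ?f m * ln (real p))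
          = (\<Sum>j\<in>{j\<in>{1..N}. p ^ k * j \<le> N}. ?f (p ^ k * j) * ln (real p))"
        by (simp only: sum.reindex o_def)
      also have "\<dots> = (\<Sum>j\<in>{j\<in>{1..N}. p ^ k * j \<le> N}. ?f j * (z ^ k * ln (real p)))"
        using q pk by (intro sum.cong refl) (auto simp: bigomega_mult bigomega_prime_power power_add)
      finally show "(\<Sum>m\<in>{m\<in>{1..N}. fst q ^ snd q dvd m}. ?f m * ln (real (fst q)))
          = (\<Sum>j\<in>{j\<in>{1..N}. fst q ^ snd q * j \<le> N}. ?f j * (z ^ snd q * ln (real (fst q))))"
        by (simp add: q)
    qed
    also have "\<dots> = (\<Sum>j=1..N. \<Sum>q\<in>{q\<in>?Q. fst q ^ snd q * j \<le> N}. ?f j * (z ^ snd q * ln (real (fst q))))"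
      by (rule sum.swap_restrict) auto
    also have "\<dots> \<le> (\<Sum>j=1..N. ?f j * (B * (N / j)))"
    proof (rule sum_mono)
      fix j assume j: "j \<in> {1..N}"
      have "{q\<in>?Q. fst q ^ snd q * j \<le> N} = prime_power_pairs (N div j)"
      proof -
        have "p ^ k * j \<le> N \<longleftrightarrow> p ^ k \<le> N div j" for p k using j by (simp add: less_eq_div_iff_mult_less_eq)
        moreover have "p ^ k \<le> N" if "p ^ k \<le> N div j" for p k using that div_le_dividend le_trans by blast
        ultimately show ?thesis by (auto simp: prime_power_pairs_def)
      qed
      then have "(\<Sum>q\<in>{q\<in>?Q. fst q ^ snd q * j \<le> N}. ?f j * (z ^ snd q * ln (real (fst q))))
          = ?f j * (\<Sum>q\<in>prime_power_pairs (N div j). z ^ snd q * ln (real (fst q)))"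
        by (simp only: sum_distrib_left)
      also have "\<dots> \<le> ?f j * (B * real (N div j))" using z by (intro mult_left_mono B) auto
      also have "real (N div j) \<le> real N / real j" by (rule of_nat_div_le_of_nat)
      finally show "(\<Sum>q\<in>{q\<in>?Q. fst q ^ snd q * j \<le> N}. ?f j * (z ^ snd q * ln (real (fst q)))) \<le> ?f j * (B * (N / j))"
        using z B(1) by (simp add: mult_left_mono)
    qed
    also have "\<dots> = B * N * ?L" by (simp add: sum_distrib_left algebra_simps)
    finally have 1: "(\<Sum>m=1..N. ?f m * ln (real m)) \<le> B * N * ?L" .
    \<comment> \<open>This is the deficit between \<open>ln N\<close> and \<open>ln m\<close>; the
      crude bound \<open>N / m\<close> leads back to the logarithmic mean.\<close>
    have 2: "(\<Sum>m=1..N. ?f m * ln (real N / m)) \<le> (\<Sum>m=1..N. ?f m * (N / m))"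
    proof (intro sum_mono mult_left_mono)
      fix m assume "m \<in> {1..N}"
      then have "real N / m > 0" by simp
      then show "ln (real N / m) \<le> N / m" using ln_le_minus_one[of "real N / m"] by simp
    qed (use z in auto)
    have "ln N * (\<Sum>m=1..N. ?f m) = (\<Sum>m=1..N. ?f m * ln (real m) + ?f m * ln (real N / m))"
      unfolding sum_distrib_left using N by (intro sum.cong refl) (auto simp: ln_div algebra_simps)
    also have "\<dots> \<le> B * N * ?L + (\<Sum>m=1..N. ?f m * (N / m))"
      unfolding sum.distrib using 1 2 by (rule add_mono)
    also have "(\<Sum>m=1..N. ?f m * (N / m)) = N * ?L" by (simp add: sum_distrib_left mult.commute)
    also have "B * N * ?L + N * ?L = (B + 1) * N * ?L" by (simp add: algebra_simps)
    also have "\<dots> \<le> (B + 1) * N * (A * ln (real N) powr z)"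
      using A(2)[OF N] B by (intro mult_left_mono) auto
    finally have 3: "ln N * (\<Sum>m=1..N. ?f m) \<le> (B + 1) * N * (A * ln (real N) powr z)" .
    have lnN: "ln (real N) > 0" using N by simp
    then have "(\<Sum>m=1..N. ?f m) \<le> (B + 1) * N * (A * ln (real N) powr z) / ln N"
      using 3 by (simp add: pos_le_divide_eq mult.commute)
    also have "\<dots> = (B + 1) * A * N * ln (real N) powr (z - 1)"
      using lnN by (simp add: powr_diff)
    finally show "(\<Sum>m=1..N. ?f m) \<le> (B + 1) * A * real N * ln (real N) powr (z - 1)" .
  qed
qed

section \<open>Unbalanced factorizations and the upper bound\<close>

lemma bigomega_eq_0_iff: "a > 0 \<Longrightarrow> bigomega a = 0 \<longleftrightarrow> a = 1"
  by (auto simp: bigomega_def prime_factorization_empty_iff)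

text \<open>Prime factors are moved one at a time into \<open>b\<close> until it holds
  \<open>k\<close> of them or \<open>a\<close> is exhausted.\<close>

lemma bigomega_split:
  assumes "a > 0" "bigomega a \<le> k + l"
  shows "\<exists>b c. a = b * c \<and> bigomega b \<le> k \<and> bigomega c \<le> l"
  using assms
proof (induction k arbitrary: a)
  case 0
  then show ?case by (intro exI[of _ 1] exI[of _ a]) simp
next
  case (Suc k)
  show ?case
  proof (cases "a = 1")
    case True
    then show ?thesis by (intro exI[of _ 1]) simp
  next
    case False
    then obtain p d where p: "prime p" "a = p * d" by (metis dvdE prime_factor_nat)
    then have "d > 0" using Suc.prems by (cases d) auto
    then have "bigomega d \<le> k + l"
      using p Suc.prems bigomega_mult[of p d] by (simp add: bigomega_prime prime_gt_0_nat)
    then obtain b c where bc: "d = b * c" "bigomega b \<le> k" "bigomega c \<le> l" using Suc.IH \<open>d > 0\<close> by blast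
    have "b > 0" using bc \<open>d > 0\<close> by (cases b) auto
    then have "bigomega (p * b) \<le> Suc k"
      using bc p bigomega_mult[of p b] by (simp add: bigomega_prime prime_gt_0_nat)
    then show ?thesis using p bc by (intro exI[of _ "p * b"] exI[of _ c]) simp
  qed
qed

text \<open>Take \<open>v\<close> with as few prime factors as possible among the divisors of \<open>a\<close> that are at least
  \<open>a\<^bsup>1/3\<^esup>\<close>. If \<open>v\<close> has \<open>j\<close> prime factors then \<open>a\<close> has more than \<open>3 (j - 1)\<close> of them, since otherwise \<open>a\<close>
  would split into three divisors below \<open>a\<^bsup>1/3\<^esup>\<close>.\<close>

lemma ex_unbalanced_factorization:
  fixes a :: nat assumes a: "a > 0"
  obtains u v where "a = u * v" "u \<le> v\<^sup>2" "2 * bigomega v \<le> bigomega u + 2" "prime v \<or> v ^ 3 \<le> a\<^sup>2"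
proof -
  let ?P = "\<lambda>v. v dvd a \<and> a \<le> v ^ 3"
  have "?P a" using power_increasing[of 1 3 a] a by simp
  then obtain v where v: "?P v" "\<And>w. ?P w \<Longrightarrow> bigomega v \<le> bigomega w"
    using ex_has_least_nat[of ?P a bigomega] by blast
  then obtain u where u: "a = u * v" by (metis dvdE mult.commute)
  have pos: "u > 0" "v > 0" using u a by (auto intro: gr0I)
  have "u * v \<le> v\<^sup>2 * v" using v(1) u by (simp add: power3_eq_cube power2_eq_square)
  then have uv: "u \<le> v\<^sup>2" using pos by simp
  show ?thesis
  proof (cases "bigomega v")
    case 0
    then have "v = 1" using pos bigomega_eq_0_iff by blast
    then show ?thesis using that[OF u uv] 0 a by simp
  next
    case (Suc k)
    have small: "w ^ 3 < a" if "w dvd a" "bigomega w \<le> k" for w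
    proof (rule ccontr)
      assume "\<not> ?thesis"
      then have "bigomega v \<le> bigomega w" using v(2) that(1) by simp
      then show False using that(2) Suc by simp
    qed
    have "\<not> bigomega a \<le> 3 * k"
    proof
      assume "bigomega a \<le> 3 * k"
      then have "bigomega a \<le> k + 2 * k" by simp
      then obtain b e where be: "a = b * e" "bigomega b \<le> k" "bigomega e \<le> 2 * k" using bigomega_split[OF a] by blast
      have "e > 0" using be a by (auto intro: gr0I)
      moreover have "bigomega e \<le> k + k" using be by simp
      ultimately obtain c d where cd: "e = c * d" "bigomega c \<le> k" "bigomega d \<le> k" using bigomega_split by blast
      have "b dvd a" "c dvd a" "d dvd a" unfolding be cd by auto
      then have "b ^ 3 < a" "c ^ 3 < a" "d ^ 3 < a" using small be cd by auto
      then have "b ^ 3 * c ^ 3 * d ^ 3 < a * a * a" by (intro mult_strict_mono) auto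
      moreover have "b ^ 3 * c ^ 3 * d ^ 3 = a ^ 3" by (simp add: be cd power_mult_distrib)
      ultimately show False by (simp add: power3_eq_cube)
    qed
    moreover have "bigomega a = bigomega u + bigomega v" using u pos bigomega_mult by simp
    \<comment> \<open>Here \<open>bigomega v = k + 1\<close> and \<open>bigomega a > 3 * k\<close>,
      so \<open>bigomega u \<ge> 2 * k\<close>.\<close>
    ultimately have om: "2 * bigomega v \<le> bigomega u + 2" using Suc by simp
    have "prime v \<or> v ^ 3 \<le> a\<^sup>2"
    proof (cases k)
      case 0
      have "v \<noteq> 1" using Suc by auto
      then obtain p d where p: "prime p" "v = p * d" by (metis dvdE prime_factor_nat)
      then have d: "d > 0" using pos by (auto intro: gr0I)
      then have "bigomega d = 0"
        using p Suc 0 bigomega_mult[of p d] by (simp add: bigomega_prime prime_gt_0_nat)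
      then have "v = p" using d bigomega_eq_0_iff p by simp
      then show ?thesis using p by simp
    next
      \<comment> \<open>Now \<open>v\<close> is composite. Splitting off a prime \<open>p\<close>
        leaves two divisors of \<open>a\<close> with at most \<open>k\<close> prime factors each; by
        minimality both cubes are below \<open>a\<close>.\<close>
      case (Suc l)
      have "v \<noteq> 1" using \<open>bigomega v = Suc k\<close> by auto
      then obtain p d where p: "prime p" "v = p * d" by (metis dvdE prime_factor_nat)
      then have d: "d > 0" using pos by (auto intro: gr0I)
      then have "bigomega d = k"
        using p \<open>bigomega v = Suc k\<close> bigomega_mult[of p d] by (simp add: bigomega_prime prime_gt_0_nat)
      moreover have "p dvd a" "d dvd a" using p u by auto
      ultimately have "p ^ 3 < a" "d ^ 3 < a" using small Suc bigomega_prime[OF p(1)] by auto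
      then have "p ^ 3 * d ^ 3 \<le> a * a" by (intro mult_mono) auto
      then show ?thesis using p by (simp add: power_mult_distrib power2_eq_square)
    qed
    then show ?thesis using that[OF u uv om] by blast
  qed
qed

section \<open>Counting integers by their number of prime factors\<close>

lemma card_bigomega_ge_le:
  fixes z :: real assumes "z \<ge> 1"
  shows "real (card {m\<in>{1..N}. k \<le> bigomega m + c}) * z ^ k \<le> z ^ c * (\<Sum>m=1..N. z ^ bigomega m)"
proof -
  have "real (card {m\<in>{1..N}. k \<le> bigomega m + c}) * z ^ k = (\<Sum>m\<in>{m\<in>{1..N}. k \<le> bigomega m + c}. z ^ k)" by simp
  \<comment> \<open>The shift \<open>c\<close> sits on the side of \<open>bigomega m\<close>, which
    avoids truncated subtraction in the exponent.\<close>
  also have "\<dots> \<le> (\<Sum>m\<in>{m\<in>{1..N}. k \<le> bigomega m + c}. z ^ (bigomega m + c))"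
    using assms by (intro sum_mono power_increasing) auto
  also have "\<dots> \<le> (\<Sum>m=1..N. z ^ (bigomega m + c))" using assms by (intro sum_mono2) auto
  finally show ?thesis by (simp add: sum_distrib_left power_add mult.commute)
qed

text \<open>Each counted \<open>m\<close> contributes exactly \<open>y ^ k\<close>, so here
  \<open>y\<close> may be below 1.\<close>

lemma card_bigomega_eq_le:
  fixes y :: real assumes "y \<ge> 0"
  shows "real (card {m\<in>{1..N}. bigomega m = k}) * y ^ k \<le> (\<Sum>m=1..N. y ^ bigomega m)"
proof -
  have "real (card {m\<in>{1..N}. bigomega m = k}) * y ^ k = (\<Sum>m\<in>{m\<in>{1..N}. bigomega m = k}. y ^ bigomega m)" by simp
  also have "\<dots> \<le> (\<Sum>m=1..N. y ^ bigomega m)" using assms by (intro sum_mono2) auto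
  finally show ?thesis .
qed

text \<open>Rankin's trick: \<open>z ^ bigomega u * (1 / z\<^sup>2) ^ bigomega v\<close> is bounded below on the pairs with
  \<open>2 * bigomega v \<le> bigomega u + 2\<close>, and the exponent \<open>z + 1 / z\<^sup>2 - 2\<close> is minimal at \<open>z\<^sup>3 = 2\<close>.\<close>

lemma card_class_mult_le:
  fixes z :: real assumes z: "1 < z" "z < 2"
  obtains C where "C > 0" "\<And>n M N c K. 3 \<le> n \<Longrightarrow> 2 \<le> M \<Longrightarrow> M \<le> n \<Longrightarrow> 2 \<le> N \<Longrightarrow> N \<le> n \<Longrightarrow>
     ln (real n) / 3 \<le> ln (real N) \<Longrightarrow> ln (real n) \<le> z ^ K \<Longrightarrow> c \<le> K \<Longrightarrow>
     real (card {u\<in>{1..M}. c < K \<longrightarrow> 2 * c \<le> bigomega u + 2}) * real (card {v\<in>{1..N}. min (bigomega v) K = c})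
       \<le> C * real M * real N * ln (real n) powr (z + 1 / z\<^sup>2 - 2)"
proof -
  define y where "y = 1 / z\<^sup>2"
  have "z\<^sup>2 > 1" using z by (simp add: one_less_power)
  then have y: "0 < y" "y < 1" by (auto simp: y_def divide_less_eq_1)
  obtain A where A: "A > 0" "\<And>N. N \<ge> 2 \<Longrightarrow> (\<Sum>m=1..N. z ^ bigomega m) \<le> A * real N * ln (real N) powr (z - 1)"
    using sum_power_bigomega_le[of z] z by auto
  obtain B where B: "B > 0" "\<And>N. N \<ge> 2 \<Longrightarrow> (\<Sum>m=1..N. y ^ bigomega m) \<le> B * real N * ln (real N) powr (y - 1)"
    using sum_power_bigomega_le[of y] y by auto
  \<comment> \<open>The first summand serves the classes \<open>c < K\<close>, the second the class
    \<open>c = K\<close>.\<close>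
  define C where "C = z\<^sup>2 * A * (B * 3 powr (1 - y)) + A"
  show ?thesis
  proof
    show "C > 0" using A B z by (simp add: C_def add_pos_pos)
    fix n M N c K :: nat
    assume n: "3 \<le> n" and M: "2 \<le> M" "M \<le> n" and N: "2 \<le> N" "N \<le> n" and
      lnN: "ln n / 3 \<le> ln N" and K: "ln n \<le> z ^ K" and c: "c \<le> K"
    let ?U = "{u\<in>{1..M}. c < K \<longrightarrow> 2 * c \<le> bigomega u + 2}" and ?V = "{v\<in>{1..N}. min (bigomega v) K = c}"
    define L where "L = ln (real n)"
    have "exp 1 \<le> real n" using exp_le n by linarith
    then have L: "L \<ge> 1" unfolding L_def by (subst ln_ge_iff) (use n in auto)
    have lnMN: "0 < ln (real M)" "ln (real M) \<le> L" "0 < ln (real N)" "ln (real N) \<le> L"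
      using M N by (auto simp: L_def)
    have SM: "(\<Sum>m=1..M. z ^ bigomega m) \<le> A * M * L powr (z - 1)"
      using A(2)[OF M(1)] lnMN z A(1) by (smt (verit) mult_left_mono mult_nonneg_nonneg of_nat_0_le_iff powr_mono2)
    have SN: "(\<Sum>m=1..N. z ^ bigomega m) \<le> A * N * L powr (z - 1)"
      using A(2)[OF N(1)] lnMN z A(1) by (smt (verit) mult_left_mono mult_nonneg_nonneg of_nat_0_le_iff powr_mono2)
    have expo: "L powr (z - 1) * L powr (y - 1) = L powr (z + 1 / z\<^sup>2 - 2)"
      by (simp add: y_def flip: powr_add)
    show "real (card ?U) * real (card ?V) \<le> C * real M * real N * ln (real n) powr (z + 1 / z\<^sup>2 - 2)"
    proof (cases "c < K")
      case True
      \<comment> \<open>The exponent \<open>y - 1\<close> is negative, so a lower bound for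
        \<open>ln N\<close> is what matters.\<close>
      have "ln (real N) powr (y - 1) \<le> (L / 3) powr (y - 1)"
        using lnN L y by (intro powr_mono2') (auto simp: L_def)
      also have "\<dots> = 3 powr (1 - y) * L powr (y - 1)"
        using L powr_minus_divide[of 3 "y - 1"] by (simp add: powr_divide)
      finally have "(\<Sum>m=1..N. y ^ bigomega m) \<le> B * N * (3 powr (1 - y) * L powr (y - 1))"
        using B(2)[OF N(1)] B(1) by (smt (verit) mult_left_mono mult_nonneg_nonneg of_nat_0_le_iff)
      moreover have "?V = {v\<in>{1..N}. bigomega v = c}" using True by auto
      ultimately have V: "real (card ?V) * y ^ c \<le> B * N * (3 powr (1 - y) * L powr (y - 1))"
        using card_bigomega_eq_le[of y N c] y by simp
      have "?U = {u\<in>{1..M}. 2 * c \<le> bigomega u + 2}" using True by auto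
      then have U: "real (card ?U) * z ^ (2 * c) \<le> z\<^sup>2 * (A * M * L powr (z - 1))"
        using card_bigomega_ge_le[of z M "2 * c" 2] z SM by (smt (verit) mult_left_mono zero_le_power2)
      have "z ^ (2 * c) * y ^ c = 1" using z by (simp add: y_def power_mult power_divide)
      then have "real (card ?U) * real (card ?V) = (real (card ?U) * z ^ (2 * c)) * (real (card ?V) * y ^ c)"
        by (simp add: algebra_simps)
      also have "\<dots> \<le> (z\<^sup>2 * (A * M * L powr (z - 1))) * (B * N * (3 powr (1 - y) * L powr (y - 1)))"
        by (rule mult_mono[OF U V]) (use z y A B in auto)
      also have "\<dots> = z\<^sup>2 * A * (B * 3 powr (1 - y)) * M * N * (L powr (z - 1) * L powr (y - 1))"
        by (simp add: algebra_simps)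
      also have "\<dots> \<le> C * M * N * (L powr (z - 1) * L powr (y - 1))"
        using A B z by (intro mult_right_mono) (auto simp: C_def)
      finally show ?thesis unfolding expo by (simp add: L_def)
    next
      case False
      \<comment> \<open>The last class collects every \<open>v\<close> with at least
        \<open>K\<close> prime factors. Since \<open>z ^ K \<ge> ln n\<close>, its size alone saves
        a full logarithm, and \<open>u\<close> can be counted trivially.\<close>
      then have "c = K" using c by simp
      then have "?V = {v\<in>{1..N}. K \<le> bigomega v + 0}" by auto
      then have "real (card ?V) * z ^ K \<le> A * N * L powr (z - 1)"
        using card_bigomega_ge_le[of z N K 0] z SN by simp
      moreover have "real (card ?V) * L \<le> real (card ?V) * z ^ K" using K by (intro mult_left_mono) (auto simp: L_def)
      ultimately have "real (card ?V) * L \<le> A * N * L powr (z - 1)" by linarith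
      then have "real (card ?V) \<le> A * N * L powr (z - 1) / L" using L by (simp add: pos_le_divide_eq)
      also have "\<dots> = A * N * L powr (z - 2)" using L powr_diff[of L "z - 1" 1] by simp
      also have "\<dots> \<le> A * N * L powr (z + 1 / z\<^sup>2 - 2)"
        using L A by (intro mult_left_mono powr_mono) auto
      finally have V: "real (card ?V) \<le> A * N * L powr (z + 1 / z\<^sup>2 - 2)" .
      have "card ?U \<le> card {1..M}" by (intro card_mono) auto
      then have "real (card ?U) * real (card ?V) \<le> M * (A * N * L powr (z + 1 / z\<^sup>2 - 2))"
        using V by (intro mult_mono) auto
      also have "\<dots> = A * (M * N * L powr (z + 1 / z\<^sup>2 - 2))" by simp
      also have "\<dots> \<le> C * (M * N * L powr (z + 1 / z\<^sup>2 - 2))"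
        using A B z by (intro mult_right_mono) (auto simp: C_def)
      finally show ?thesis by (simp add: L_def mult.assoc)
    qed
  qed
qed

section \<open>Bounds for the two ranges of prime factors\<close>

lemma card_le_if_factors_in:
  assumes nsp: "no_square_product 6 A" and B: "B \<subseteq> A" and fin: "finite U" "finite V"
    and fg: "\<And>a. a \<in> B \<Longrightarrow> f a * g a = a" "f ` B \<subseteq> U" "g ` B \<subseteq> V"
  shows "real (card B) \<le> 4 * (real (card U) + real (card V)) + 6 * (real (card U) * real (card V)) powr (2/3)"
proof -
  define E where "E = (\<lambda>a. (f a, g a)) ` B"
  have "inj_on (\<lambda>a. (f a, g a)) B" by (rule inj_onI) (metis fg(1) prod.inject)
  then have "card B = card E" by (simp add: E_def card_image)
  moreover have "hexagon_free E"
    by (rule hexagon_free_if_no_square_product[OF nsp]) (use B fg(1) in \<open>auto simp: E_def inj_on_def\<close>)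
  then have "real (card E) \<le> 4 * (real (card U) + real (card V)) + 6 * (real (card U) * real (card V)) powr (2/3)"
    by (rule hexagon_free_card_le[OF _ fin]) (use fg in \<open>auto simp: E_def\<close>)
  ultimately show ?thesis by simp
qed

text \<open>Join each chosen prime to its cofactor, which is at most \<open>T\<close>. Degrees up to
  two are paid for by the two prime counts, and the excess over two is bounded by twice the square
  of the number of cofactors.\<close>

lemma card_le_if_large_prime_factor:
  fixes T :: real
  assumes nsp: "no_square_product 6 A" and A: "A \<subseteq> {1..n}"
    and large: "\<And>a. a \<in> A \<Longrightarrow> \<exists>p. prime p \<and> p dvd a \<and> real a \<le> T * p" and T: "T \<ge> 0"
  shows "real (card A) \<le> real (prime_pi (real n)) + real (prime_pi (real n / 2)) + 2 * T\<^sup>2"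
proof -
  obtain P where P: "\<And>a. a \<in> A \<Longrightarrow> prime (P a) \<and> P a dvd a \<and> real a \<le> T * P a" using large by metis
  define E where "E = (\<lambda>a. (a div P a, P a)) ` A"
  define U where "U = {1..nat \<lfloor>T\<rfloor>}"
  define V where "V = {p. prime p \<and> p \<le> n}"
  have finA: "finite A" using A finite_subset by blast
  have mult: "a div P a * P a = a" if "a \<in> A" for a using P[OF that] by simp
  have inj: "inj_on (\<lambda>a. (a div P a, P a)) A" by (rule inj_onI) (metis mult prod.inject)
  have hex: "hexagon_free E"
    by (rule hexagon_free_if_no_square_product[OF nsp]) (use mult in \<open>auto simp: E_def inj_on_def\<close>)
  have sub: "E \<subseteq> U \<times> V"
  proof -
    have "a div P a \<in> U \<and> P a \<in> V" if a: "a \<in> A" for a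
    proof -
      have a1: "1 \<le> a" "a \<le> n" using A a by auto
      have pos: "P a > 0" using P[OF a] prime_gt_0_nat by blast
      have "a div P a > 0" using mult[OF a] a1 by (metis gr0I mult_zero_left not_one_le_zero)
      moreover have "real (a div P a) * P a \<le> T * P a" using mult[OF a] P[OF a] by (metis of_nat_mult)
      then have "real (a div P a) \<le> T" using pos by simp
      then have "a div P a \<le> nat \<lfloor>T\<rfloor>" by (simp add: le_nat_iff le_floor_iff)
      moreover have "P a \<le> n" using P[OF a] a1 dvd_imp_le[of "P a" a] by simp
      ultimately show ?thesis using P[OF a] by (simp add: U_def V_def)
    qed
    then show ?thesis by (auto simp: E_def)
  qed
  have fin: "finite U" "finite V" "finite E" using finA by (auto simp: U_def V_def E_def)
  define d where "d p = card {u. (u, p) \<in> E}" for p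
  have "card A = card E" unfolding E_def by (rule card_image[OF inj, symmetric])
  also have "\<dots> = (\<Sum>p\<in>V. d p)" unfolding d_def using fin sub by (intro card_le_sum_fibres) auto
  \<comment> \<open>Truncated subtraction makes the excess vanish up to degree two. Degree at least
    two forces a cofactor \<open>u \<ge> 2\<close>, hence \<open>2 * p \<le> n\<close>.\<close>
  also have "\<dots> \<le> (\<Sum>p\<in>V. (1 + of_bool (2 * p \<le> n)) + (d p - 2))"
  proof (rule sum_mono)
    fix p assume p: "p \<in> V"
    have "2 * p \<le> n" if "d p \<ge> 2"
    proof -
      have "\<not> {u. (u, p) \<in> E} \<subseteq> {1}"
        using card_mono[of "{1::nat}" "{u. (u, p) \<in> E}"] that by (auto simp: d_def)
      then obtain u where u: "(u, p) \<in> E" "u \<noteq> 1" by blast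
      moreover have "u \<ge> 1" using u sub by (auto simp: U_def)
      ultimately have "u \<ge> 2" by simp
      have "u * p \<in> A" using u mult by (auto simp: E_def)
      then have "u * p \<le> n" using A by auto
      then show ?thesis using mult_le_mono1[OF \<open>u \<ge> 2\<close>, of p] by linarith
    qed
    then show "d p \<le> (1 + of_bool (2 * p \<le> n)) + (d p - 2)" by (cases "d p \<ge> 2") auto
  qed
  also have "\<dots> = card V + card {p\<in>V. 2 * p \<le> n} + (\<Sum>p\<in>V. d p - 2)"
    using fin by (simp only: sum.distrib sum_of_bool_eq) (simp add: Int_def)
  also have "(\<Sum>p\<in>V. d p - 2) \<le> 2 * (card U)\<^sup>2"
    unfolding d_def by (rule hexagon_free_sum_excess_degree[OF hex fin(1,2) sub])
  finally have "real (card A) \<le> real (card V) + real (card {p\<in>V. 2 * p \<le> n}) + 2 * (real (card U))\<^sup>2"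
    by (simp flip: of_nat_power of_nat_add)
  moreover have "card V = prime_pi (real n)" by (simp add: V_def prime_pi_def)
  moreover have "{p\<in>V. 2 * p \<le> n} = {p. prime p \<and> real p \<le> real n / 2}" by (auto simp: V_def)
  then have "card {p\<in>V. 2 * p \<le> n} = prime_pi (real n / 2)" by (simp add: prime_pi_def)
  moreover have "(real (card U))\<^sup>2 \<le> T\<^sup>2" using T by (intro power_mono) (auto simp: U_def)
  ultimately show ?thesis by simp
qed

lemma ex_dyadic_interval:
  fixes x :: real assumes "x \<ge> 1"
  obtains h :: nat where "2 ^ h \<le> x" "x < 2 ^ (h + 1)"
proof -
  have "1 \<le> nat \<lfloor>x\<rfloor>" using assms by (simp add: le_nat_iff le_floor_iff)
  then obtain h where h: "2 ^ h \<le> nat \<lfloor>x\<rfloor>" "nat \<lfloor>x\<rfloor> < 2 ^ (h + 1)" using ex_power_ivl1[of 2] by blast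
  have "(2::int) ^ h \<le> \<lfloor>x\<rfloor>" "\<lfloor>x\<rfloor> < 2 ^ (h + 1)"
    using h assms by (simp_all add: le_nat_iff nat_less_iff)
  then have "2 ^ h \<le> x" "x < 2 ^ (h + 1)" by (simp_all add: le_floor_iff floor_less_iff)
  then show ?thesis by (rule that)
qed

text \<open>From \<open>z ^ 3 = 2\<close> follows \<open>1 / z\<^sup>2 = z / 2\<close>, which makes
  the exponent linear in \<open>z\<close>.\<close>

lemma exponent_optimum:
  fixes z :: real defines "z \<equiv> 2 powr (1/3)"
  shows "1 < z" "z < 2" "1 + (2/3) * (z + 1 / z\<^sup>2 - 2) = z - 1/3"
proof -
  have "(2::real) powr 0 < 2 powr (1/3)" "(2::real) powr (1/3) < 2 powr 1" by (simp_all only: powr_less_cancel_iff)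
  then show z: "1 < z" "z < 2" by (simp_all add: z_def)
  have "z ^ 3 = z powr 3" using z by (simp add: powr_numeral)
  also have "\<dots> = 2" by (simp add: z_def powr_powr)
  finally have "z * z\<^sup>2 = 2" by (simp add: power3_eq_cube power2_eq_square)
  then have "1 / z\<^sup>2 = z / 2" using z by (simp add: field_simps)
  then show "1 + (2/3) * (z + 1 / z\<^sup>2 - 2) = z - 1/3" by (simp only:) (simp add: field_simps)
qed

text \<open>With \<open>T\<close> the cube root of \<open>n\<close>, factorizations
  \<open>f a * g a\<close> with \<open>g a < T\<close> form one small graph. The others are sorted
  by the dyadic range of \<open>g a\<close> and by its class \<open>c\<close>. The number of ranges
  adds a full power of \<open>ln n\<close>, the number of classes only the factor with the iterated
  logarithm.\<close>

lemma card_le_if_small_prime_factors: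
  fixes z :: real defines "z \<equiv> 2 powr (1/3)"
  obtains C where "C > 0" "\<And>n A. 27 \<le> n \<Longrightarrow> no_square_product 6 A \<Longrightarrow> A \<subseteq> {1..n} \<Longrightarrow>
     (\<And>a p. a \<in> A \<Longrightarrow> prime p \<Longrightarrow> p dvd a \<Longrightarrow> real p \<le> real n powr (2/3)) \<Longrightarrow>
     real (card A) \<le> C * (ln (ln (real n)) / ln z + 2) * real n powr (2/3) * ln (real n) powr (z - 1/3)"
proof -
  define \<delta> where "\<delta> = z + 1 / z\<^sup>2 - 2"
  have z: "1 < z" "z < 2" and \<delta>: "1 + (2/3) * \<delta> = z - 1/3"
    using exponent_optimum by (simp_all add: z_def \<delta>_def)
  obtain C where C: "C > 0" and cls: "\<And>n M N c K. 3 \<le> n \<Longrightarrow> 2 \<le> M \<Longrightarrow> M \<le> n \<Longrightarrow> 2 \<le> N \<Longrightarrow> N \<le> n \<Longrightarrow>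
     ln (real n) / 3 \<le> ln (real N) \<Longrightarrow> ln (real n) \<le> z ^ K \<Longrightarrow> c \<le> K \<Longrightarrow>
     real (card {u\<in>{1..M}. c < K \<longrightarrow> 2 * c \<le> bigomega u + 2}) * real (card {v\<in>{1..N}. min (bigomega v) K = c})
       \<le> C * real M * real N * ln (real n) powr \<delta>"
    using card_class_mult_le[OF z, folded \<delta>_def] by blast
  define D where "D = (2 * C) powr (2/3)"
  show ?thesis
  proof
    \<comment> \<open>Here 38 is 14 from the elements with \<open>g a < T\<close> plus 24 from the
      vertex terms of the other graphs.\<close>
    show "38 + 12 * D > 0" by (simp add: D_def add_pos_nonneg)
    fix n :: nat and A :: "nat set"
    assume n: "27 \<le> n" and nsp: "no_square_product 6 A" and A: "A \<subseteq> {1..n}"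
      and small: "\<And>a p. a \<in> A \<Longrightarrow> prime p \<Longrightarrow> p dvd a \<Longrightarrow> real p \<le> real n powr (2/3)"
    define L where "L = ln (real n)"
    define T where "T = real n powr (1/3)"
    define K where "K = nat \<lceil>ln L / ln z\<rceil>"
    have "exp 1 \<le> real n" using exp_le n by linarith
    then have L: "L \<ge> 1" unfolding L_def by (subst ln_ge_iff) (use n in auto)
    have T2: "T\<^sup>2 = real n powr (2/3)" by (simp add: T_def power2_eq_square flip: powr_add)
    have T3: "T ^ 3 = real n" using n by (simp add: T_def power3_eq_cube flip: powr_add)
    have lnT: "ln T = L / 3" using n by (simp add: T_def L_def ln_powr)
    have "3 ^ 3 \<le> T ^ 3" using n T3 by simp
    moreover have "T \<ge> 0" by (simp add: T_def)
    ultimately have T: "T \<ge> 3" using power_mono_iff[of 3 T 3] by simp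
    have TT: "T \<le> T\<^sup>2" "2 * T\<^sup>2 \<le> real n"
    proof -
      show "T \<le> T\<^sup>2" using T by (simp add: power2_eq_square)
      have "2 * T\<^sup>2 \<le> T * T\<^sup>2" using T by (intro mult_right_mono) auto
      then show "2 * T\<^sup>2 \<le> real n" using T3 by (simp add: power3_eq_cube power2_eq_square)
    qed
    have finA: "finite A" using A finite_subset by blast

    have "\<exists>u v. a = u * v \<and> u \<le> v\<^sup>2 \<and> 2 * bigomega v \<le> bigomega u + 2 \<and> (prime v \<or> v ^ 3 \<le> a\<^sup>2)" if "a \<in> A" for a
      using ex_unbalanced_factorization[of a] A that by (metis atLeastAtMost_iff less_le_trans less_one subsetD)
    then obtain f g where fg: "\<And>a. a \<in> A \<Longrightarrow> a = f a * g a \<and> f a \<le> (g a)\<^sup>2 \<and>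
        2 * bigomega (g a) \<le> bigomega (f a) + 2 \<and> (prime (g a) \<or> (g a) ^ 3 \<le> a\<^sup>2)" by metis
    have pos: "1 \<le> f a" "1 \<le> g a" if "a \<in> A" for a
      using fg[OF that] A that by (metis (no_types) atLeastAtMost_iff gr0I mult_is_0 not_one_le_zero subsetD One_nat_def Suc_leI)+
    \<comment> \<open>A prime \<open>g a\<close> is controlled by the hypothesis on prime factors,
      any other by \<open>(g a) ^ 3 \<le> a\<^sup>2\<close>.\<close>
    have gle: "real (g a) \<le> T\<^sup>2" if a: "a \<in> A" for a
    proof (cases "prime (g a)")
      case True
      have "g a dvd a" using fg[OF a] by (metis dvd_triv_right)
      then show ?thesis using small[OF a True] T2 by simp
    next
      case False
      then have "(g a) ^ 3 \<le> a\<^sup>2" using fg[OF a] by blast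
      also have "a\<^sup>2 \<le> n\<^sup>2" using A a by (intro power_mono) auto
      finally have "real ((g a) ^ 3) \<le> real (n\<^sup>2)" by (rule of_nat_mono)
      then have "real (g a) ^ 3 \<le> (real n)\<^sup>2" by simp
      also have "\<dots> = (T\<^sup>2) ^ 3" by (simp flip: T3 power_mult)
      finally show ?thesis using power_mono_iff[of "real (g a)" "T\<^sup>2" 3] by simp
    qed

    define S where "S = {a\<in>A. real (g a) < T}"
    define B where "B = {a\<in>A. T \<le> real (g a)}"
    have cardA: "card A \<le> card S + card B"
    proof -
      have "A = S \<union> B" by (auto simp: S_def B_def)
      then show ?thesis using card_Un_le[of S B] by simp
    qed
    have cardS: "real (card S) \<le> 14 * T\<^sup>2"
    proof -
      let ?U = "{1..nat \<lfloor>T\<^sup>2\<rfloor>}" and ?V = "{1..nat \<lfloor>T\<rfloor>}"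
      have "f a \<in> ?U \<and> g a \<in> ?V" if a: "a \<in> S" for a
      proof -
        have aA: "a \<in> A" and gT: "real (g a) < T" using a by (auto simp: S_def)
        have "real (f a) \<le> (real (g a))\<^sup>2" using fg[OF aA] by (simp flip: of_nat_power)
        also have "\<dots> \<le> T\<^sup>2" using gT by (intro power_mono) auto
        finally show ?thesis using gT pos[OF aA] by (simp add: le_nat_iff le_floor_iff)
      qed
      then have "real (card S) \<le> 4 * (real (card ?U) + real (card ?V)) + 6 * (real (card ?U) * real (card ?V)) powr (2/3)"
        using fg by (intro card_le_if_factors_in[OF nsp, of S _ _ f g]) (auto simp: S_def)
      also have "\<dots> \<le> 4 * (T\<^sup>2 + T) + 6 * (T\<^sup>2 * T) powr (2/3)"
        using T by (intro add_mono mult_left_mono powr_mono2 mult_mono) auto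
      also have "T\<^sup>2 * T = real n" using T3 by (simp add: power3_eq_cube power2_eq_square)
      also have "4 * (T\<^sup>2 + T) + 6 * real n powr (2/3) \<le> 14 * T\<^sup>2" using T2 TT by simp
      finally show ?thesis .
    qed

    have K: "L \<le> z ^ K" "real K + 1 \<le> ln L / ln z + 2"
    proof -
      have "L = z powr (ln L / ln z)" using L z by (simp add: powr_def)
      also have "\<dots> \<le> z powr real K" using z by (intro powr_mono) (auto simp: K_def real_nat_ceiling_ge)
      finally show "L \<le> z ^ K" using z by (simp add: powr_realpow)
      have "ln L / ln z \<ge> 0" using L z by simp
      then show "real K + 1 \<le> ln L / ln z + 2" unfolding K_def by linarith
    qed
    \<comment> \<open>If \<open>g a\<close> is at least \<open>T * 2 ^ h\<close>, then
      \<open>f a\<close> is at most \<open>n / (T * 2 ^ h)\<close>, that is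
      \<open>T\<^sup>2 / 2 ^ h\<close>. The product of the two bounds is \<open>2 * n\<close> for
      every \<open>h\<close>.\<close>
    define M where "M h = nat \<lfloor>T\<^sup>2 / 2 ^ h\<rfloor>" for h :: nat
    define N where "N h = nat \<lfloor>T * 2 ^ (h + 1)\<rfloor>" for h :: nat
    have Mle: "real (M h) \<le> T\<^sup>2 / 2 ^ h" and Nle: "real (N h) \<le> T * 2 ^ (h + 1)" for h
      using T by (auto simp: M_def N_def)
    define H where "H = nat \<lfloor>log 2 T\<rfloor>"
    have log: "log 2 T \<ge> 0" using T by simp
    have H: "2 ^ H \<le> T" "real H + 1 \<le> 2 * L"
    proof -
      have "(2::real) ^ H = 2 powr real H" by (simp add: powr_realpow)
      also have "\<dots> \<le> 2 powr log 2 T" using log by (intro powr_mono) (auto simp: H_def)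
      also have "\<dots> = T" using T by simp
      finally show "2 ^ H \<le> T" .
      have "real H \<le> log 2 T" using log by (simp add: H_def)
      also have "log 2 T = L / 3 / ln 2" by (simp add: log_def lnT)
      \<comment> \<open>The bound \<open>ln 2 \<ge> 1/2\<close> comes from
        \<open>ln y \<le> y - 1\<close> at \<open>y = 1/2\<close>.\<close>
      also have "\<dots> \<le> L / 3 / (1/2)"
        using L ln_le_minus_one[of "1/2"] by (intro divide_left_mono) (auto simp: ln_div)
      finally show "real H + 1 \<le> 2 * L" using L by simp
    qed
    have leH: "h \<le> H" if "2 ^ h \<le> T" for h
    proof -
      have "real h \<le> log 2 T" by (rule le_log_of_power[OF that]) simp
      then show ?thesis by (simp add: H_def le_nat_iff le_floor_iff)
    qed
    define G where "G h c = {a\<in>B. T * 2 ^ h \<le> g a \<and> g a < T * 2 ^ (h + 1) \<and> min (bigomega (g a)) K = c}" for h c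
    have cover: "B \<subseteq> (\<Union>h\<le>H. \<Union>c\<le>K. G h c)"
    proof
      fix a assume a: "a \<in> B"
      then have aA: "a \<in> A" and gT: "T \<le> real (g a)" by (auto simp: B_def)
      have "real (g a) / T \<ge> 1" using gT T by simp
      then obtain h where h: "2 ^ h \<le> real (g a) / T" "real (g a) / T < 2 ^ (h + 1)" by (rule ex_dyadic_interval)
      have "real (g a) / T \<le> T" using gle[OF aA] T by (simp add: divide_le_eq power2_eq_square)
      then have "h \<le> H" using h leH[of h] by linarith
      moreover have "T * 2 ^ h \<le> g a" "g a < T * 2 ^ (h + 1)"
        using h T by (simp_all add: pos_le_divide_eq pos_divide_less_eq mult.commute)
      then have "a \<in> G h (min (bigomega (g a)) K)" using a by (simp add: G_def)
      moreover have "min (bigomega (g a)) K \<le> K" by simp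
      ultimately show "a \<in> (\<Union>h\<le>H. \<Union>c\<le>K. G h c)" by blast
    qed
    have cardG: "real (card (G h c)) \<le> 4 * (T\<^sup>2 / 2 ^ h + T * 2 ^ (h + 1)) + 6 * D * T\<^sup>2 * L powr ((2/3) * \<delta>)"
      if hc: "h \<le> H" "c \<le> K" for h c
    proof -
      let ?U = "{u\<in>{1..M h}. c < K \<longrightarrow> 2 * c \<le> bigomega u + 2}" and ?V = "{v\<in>{1..N h}. min (bigomega v) K = c}"
      have "(2::real) ^ h \<le> 2 ^ H" using hc by (intro power_increasing) auto
      then have hT: "2 ^ h \<le> T" using H by linarith
      have "T * 2 ^ h \<le> T * T" using hT T by (intro mult_left_mono) auto
      then have h1: "T \<le> T\<^sup>2 / 2 ^ h" by (simp add: pos_le_divide_eq power2_eq_square)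
      have h2: "T\<^sup>2 / 2 ^ h \<le> T\<^sup>2" using mult_left_mono[of 1 "2 ^ h" "T\<^sup>2"] by (simp add: divide_le_eq)
      have h3: "2 * T \<le> T * 2 ^ (h + 1)" using T one_le_power[of "2::real" h] by simp
      have h4: "T * 2 ^ (h + 1) \<le> 2 * T\<^sup>2" using \<open>T * 2 ^ h \<le> T * T\<close> by (simp add: power2_eq_square)
      have M2: "2 \<le> M h" using h1 T by (simp add: M_def le_nat_iff le_floor_iff)
      have "real (M h) \<le> real n" using Mle[of h] h2 TT by simp
      then have Mn: "M h \<le> n" by simp
      have "T * 2 ^ (h + 1) - 1 \<le> real (N h)" using T by (simp add: N_def)
      then have NT: "T \<le> real (N h)" using h3 T by linarith
      then have N2: "2 \<le> N h" using T by linarith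
      have "real (N h) \<le> real n" using Nle[of h] h4 TT by linarith
      then have Nn: "N h \<le> n" by simp
      have lnN: "ln (real n) / 3 \<le> ln (real (N h))"
        using NT T unfolding lnT[unfolded L_def, symmetric] by simp
      have prod: "real (card ?U) * real (card ?V) \<le> C * real (M h) * real (N h) * L powr \<delta>"
        unfolding L_def by (rule cls) (use n M2 Mn N2 Nn lnN K(1) hc in \<open>auto simp: L_def\<close>)
      have "real (M h) * real (N h) \<le> (T\<^sup>2 / 2 ^ h) * (T * 2 ^ (h + 1))"
        using T by (intro mult_mono Mle Nle) auto
      also have "\<dots> = 2 * real n" using T3 by (simp add: power3_eq_cube power2_eq_square)
      finally have MN: "C * L powr \<delta> * (real (M h) * real (N h)) \<le> C * L powr \<delta> * (2 * real n)"
        using C by (intro mult_left_mono) auto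
      have "f a \<in> ?U \<and> g a \<in> ?V" if a: "a \<in> G h c" for a
      proof -
        have aA: "a \<in> A" and g: "T * 2 ^ h \<le> g a" "g a < T * 2 ^ (h + 1)" "min (bigomega (g a)) K = c"
          using a by (auto simp: G_def B_def)
        have "real (f a) * (T * 2 ^ h) \<le> real (f a) * real (g a)" using g by (intro mult_left_mono) auto
        also have "\<dots> = real a" using fg[OF aA] by (metis of_nat_mult)
        also have "\<dots> \<le> T\<^sup>2 * T" using A aA T3 by (auto simp: power3_eq_cube power2_eq_square)
        finally have "real (f a) * 2 ^ h * T \<le> T\<^sup>2 * T" by (simp add: algebra_simps)
        then have "real (f a) * 2 ^ h \<le> T\<^sup>2" using T by simp
        then have "real (f a) \<le> T\<^sup>2 / 2 ^ h" by (simp add: pos_le_divide_eq)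
        then have "f a \<le> M h" by (simp add: M_def le_nat_iff le_floor_iff)
        moreover have "g a \<le> N h" using g by (simp add: N_def le_nat_iff le_floor_iff)
        moreover have "2 * c \<le> bigomega (f a) + 2" if "c < K" using fg[OF aA] g(3) that by linarith
        ultimately show ?thesis using pos[OF aA] g(3) by simp
      qed
      then have "real (card (G h c)) \<le> 4 * (real (card ?U) + real (card ?V)) + 6 * (real (card ?U) * real (card ?V)) powr (2/3)"
        using fg by (intro card_le_if_factors_in[OF nsp, of "G h c" _ _ f g]) (auto simp: G_def B_def)
      also have "\<dots> \<le> 4 * (T\<^sup>2 / 2 ^ h + T * 2 ^ (h + 1)) + 6 * (2 * C * real n * L powr \<delta>) powr (2/3)"
      proof (intro add_mono mult_left_mono powr_mono2)
        have "card ?U \<le> card {1..M h}" by (intro card_mono) auto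
        then show "real (card ?U) \<le> T\<^sup>2 / 2 ^ h" using Mle[of h] by simp
        have "card ?V \<le> card {1..N h}" by (intro card_mono) auto
        then show "real (card ?V) \<le> T * 2 ^ (h + 1)" using Nle[of h] by simp
        show "real (card ?U) * real (card ?V) \<le> 2 * C * real n * L powr \<delta>"
          using prod MN by (simp add: algebra_simps)
      qed auto
      also have "(2 * C * real n * L powr \<delta>) powr (2/3) = D * T\<^sup>2 * L powr ((2/3) * \<delta>)"
        using C by (simp add: D_def T2 powr_mult powr_powr mult.commute)
      finally show ?thesis by simp
    qed
    have cardB: "real (card B) \<le> (real K + 1) * (24 * T\<^sup>2 + 12 * D * T\<^sup>2 * L powr (z - 1/3))"
    proof -
      have finG: "finite (G h c)" for h c using finA by (simp add: G_def B_def)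
      have "card B \<le> card (\<Union>h\<le>H. \<Union>c\<le>K. G h c)" using finG by (intro card_mono cover) auto
      also have "\<dots> \<le> (\<Sum>h\<le>H. card (\<Union>c\<le>K. G h c))" by (intro card_UN_le) auto
      also have "\<dots> \<le> (\<Sum>h\<le>H. \<Sum>c\<le>K. card (G h c))" by (intro sum_mono card_UN_le) auto
      finally have "real (card B) \<le> (\<Sum>h\<le>H. \<Sum>c\<le>K. real (card (G h c)))"
        by (simp flip: of_nat_sum)
      also have "\<dots> \<le> (\<Sum>h\<le>H. \<Sum>c\<le>K. 4 * (T\<^sup>2 / 2 ^ h + T * 2 ^ (h + 1)) + 6 * D * T\<^sup>2 * L powr ((2/3) * \<delta>))"
        by (intro sum_mono cardG) auto
      also have "\<dots> = (real K + 1) * (4 * (T\<^sup>2 * (\<Sum>h\<le>H. (1/2) ^ h) + 2 * T * (\<Sum>h\<le>H. 2 ^ h))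
          + (real H + 1) * (6 * D * T\<^sup>2 * L powr ((2/3) * \<delta>)))"
        by (simp add: sum.distrib sum_distrib_left sum_divide_distrib power_divide algebra_simps)
      \<comment> \<open>The vertex terms are geometric in \<open>h\<close> and total
        \<open>24 * T\<^sup>2\<close> per class, so only the main term is multiplied by the number
        of dyadic ranges.\<close>
      also have "\<dots> \<le> (real K + 1) * (4 * (T\<^sup>2 * 2 + 2 * T * (2 * T))
          + 2 * L * (6 * D * T\<^sup>2 * L powr ((2/3) * \<delta>)))"
      proof (intro mult_left_mono add_mono mult_right_mono)
        show "(\<Sum>h\<le>H. (1/2::real) ^ h) \<le> 2"
          using sum_power_le_geometric[of "1/2" 0 H] by (simp add: atLeast0AtMost)
        have "(\<Sum>h\<le>H. (2::real) ^ h) = 2 * 2 ^ H - 1" by (simp add: sum_gp0)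
        then show "(\<Sum>h\<le>H. (2::real) ^ h) \<le> 2 * T" using H(1) by linarith
      qed (use T H L in \<open>auto simp: D_def\<close>)
      also have "\<dots> = (real K + 1) * (24 * T\<^sup>2 + 12 * D * T\<^sup>2 * (L powr 1 * L powr ((2/3) * \<delta>)))"
        using L by (simp add: power2_eq_square algebra_simps)
      also have "L powr 1 * L powr ((2/3) * \<delta>) = L powr (z - 1/3)"
        unfolding powr_add[symmetric] \<delta> ..
      finally show ?thesis .
    qed
    have Lz: "L powr (z - 1/3) \<ge> 1" using L z by (intro ge_one_powr_ge_zero) auto
    have "real (card A) \<le> 14 * T\<^sup>2 + (real K + 1) * (24 * T\<^sup>2 + 12 * D * T\<^sup>2 * L powr (z - 1/3))"
      using cardA cardS cardB by linarith
    also have "\<dots> \<le> (real K + 1) * (14 * T\<^sup>2 * L powr (z - 1/3)) +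
        (real K + 1) * (24 * T\<^sup>2 * L powr (z - 1/3) + 12 * D * T\<^sup>2 * L powr (z - 1/3))"
    proof (intro add_mono mult_left_mono)
      have "14 * T\<^sup>2 * 1 \<le> 14 * T\<^sup>2 * L powr (z - 1/3)" using Lz by (intro mult_left_mono) auto
      moreover have "1 * (14 * T\<^sup>2 * L powr (z - 1/3)) \<le> (real K + 1) * (14 * T\<^sup>2 * L powr (z - 1/3))"
        by (intro mult_right_mono) auto
      ultimately show "14 * T\<^sup>2 \<le> (real K + 1) * (14 * T\<^sup>2 * L powr (z - 1/3))" by linarith
      show "24 * T\<^sup>2 \<le> 24 * T\<^sup>2 * L powr (z - 1/3)" using mult_left_mono[OF Lz, of "24 * T\<^sup>2"] by simp
    qed (auto simp: D_def)
    also have "\<dots> = (real K + 1) * ((38 + 12 * D) * T\<^sup>2 * L powr (z - 1/3))" by (simp add: algebra_simps)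
    also have "\<dots> \<le> (ln L / ln z + 2) * ((38 + 12 * D) * T\<^sup>2 * L powr (z - 1/3))"
      using K(2) by (intro mult_right_mono) (auto simp: D_def)
    finally show "real (card A) \<le> (38 + 12 * D) * (ln (ln (real n)) / ln z + 2) * real n powr (2/3) * ln (real n) powr (z - 1/3)"
      by (simp add: L_def T2 mult_ac)
  qed
qed

text \<open>A maximal set is split according to whether an element has a prime factor above
  \<open>n powr (2/3)\<close>. Only that part produces the prime counts; constants and the iterated
  logarithm disappear in \<open>ln n powr \<epsilon>\<close>.\<close>

theorem corollary1:
  shows "\<forall>\<epsilon>::real. \<epsilon> > 0 \<longrightarrow> (\<exists>n\<^sub>0::nat. \<forall>n::nat. n \<ge> n\<^sub>0 \<longrightarrow>
    real (F 6 n) \<le> real (prime_pi (real n)) + real (prime_pi (real n / 2))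
      + real n powr (2/3) * ln (real n) powr (2 powr (1/3) - 1/3 + \<epsilon>))"
proof (intro allI impI)
  fix \<epsilon> :: real assume \<epsilon>: "\<epsilon> > 0"
  define z :: real where "z = 2 powr (1/3)"
  have z: "1 < z" using exponent_optimum(1) by (simp add: z_def)
  obtain C where C: "C > 0" and small: "\<And>n A. 27 \<le> n \<Longrightarrow> no_square_product 6 A \<Longrightarrow> A \<subseteq> {1..n} \<Longrightarrow>
     (\<And>a p. a \<in> A \<Longrightarrow> prime p \<Longrightarrow> p dvd a \<Longrightarrow> real p \<le> real n powr (2/3)) \<Longrightarrow>
     real (card A) \<le> C * (ln (ln (real n)) / ln z + 2) * real n powr (2/3) * ln (real n) powr (z - 1/3)"
    using card_le_if_small_prime_factors[folded z_def] by blast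
  define b where "b = C / ln z"
  have "b > 0" using C z by (simp add: b_def)
  \<comment> \<open>The left side collects the 2 from the large-prime part and
    \<open>C * (ln (ln n) / ln z + 2)\<close>.\<close>
  then have "eventually (\<lambda>n. (2 + 2 * C) + b * ln (ln (real n)) \<le> ln (real n) powr \<epsilon>) at_top"
    using \<epsilon> by real_asymp
  then obtain n1 where n1: "\<And>n. n \<ge> n1 \<Longrightarrow> (2 + 2 * C) + b * ln (ln (real n)) \<le> ln (real n) powr \<epsilon>"
    unfolding eventually_at_top_linorder by blast
  show "\<exists>n\<^sub>0. \<forall>n\<ge>n\<^sub>0. real (F 6 n) \<le> real (prime_pi (real n)) + real (prime_pi (real n / 2))
      + real n powr (2/3) * ln (real n) powr (2 powr (1/3) - 1/3 + \<epsilon>)"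
  proof (intro exI[of _ "max n1 27"] allI impI)
    fix n assume "n \<ge> max n1 27"
    then have n: "n \<ge> n1" "n \<ge> 27" by auto
    let ?cards = "{card A | A. A \<subseteq> {1..n} \<and> no_square_product 6 A}"
    have "finite ?cards" by (rule finite_subset[of _ "card ` Pow {1..n}"]) auto
    moreover have "card {} \<in> ?cards" by (force simp: no_square_product_def)
    ultimately have "F 6 n \<in> ?cards" unfolding F_def using Max_in by blast
    then obtain A where A: "F 6 n = card A" "A \<subseteq> {1..n}" "no_square_product 6 A" by blast
    define A1 where "A1 = {a\<in>A. \<exists>p. prime p \<and> p dvd a \<and> real p > real n powr (2/3)}"
    have sub: "no_square_product 6 A'" if "A' \<subseteq> A" for A'
      using A(3) that unfolding no_square_product_def by blast
    have A1A: "A1 \<subseteq> A" by (auto simp: A1_def)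
    define T where "T = real n powr (1/3)"
    have "real (card A1) \<le> real (prime_pi (real n)) + real (prime_pi (real n / 2)) + 2 * T\<^sup>2"
    proof (rule card_le_if_large_prime_factor)
      fix a assume a: "a \<in> A1"
      then obtain p where p: "prime p" "p dvd a" "real p > real n powr (2/3)" by (auto simp: A1_def)
      have "real a \<le> real n" using a A(2) by (auto simp: A1_def)
      also have "\<dots> = T * real n powr (2/3)" using n by (simp add: T_def flip: powr_add)
      also have "\<dots> \<le> T * p" using p by (intro mult_left_mono) (auto simp: T_def)
      finally show "\<exists>p. prime p \<and> p dvd a \<and> real a \<le> T * p" using p by blast
    qed (use A sub A1A in \<open>auto simp: T_def\<close>)
    moreover have "T\<^sup>2 = real n powr (2/3)" by (simp add: T_def power2_eq_square flip: powr_add)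
    moreover have "real (card (A - A1)) \<le> C * (ln (ln (real n)) / ln z + 2) * real n powr (2/3) * ln (real n) powr (z - 1/3)"
    proof (rule small[OF n(2)])
      show "real p \<le> real n powr (2/3)" if "a \<in> A - A1" "prime p" "p dvd a" for a p
        using that unfolding A1_def by (metis (mono_tags, lifting) DiffD1 DiffD2 mem_Collect_eq not_le)
    qed (use A sub in auto)
    moreover have "card A \<le> card A1 + card (A - A1)"
      using card_Un_le[of A1 "A - A1"] A1A by (simp add: Un_absorb1)
    ultimately have "real (F 6 n) \<le> real (prime_pi (real n)) + real (prime_pi (real n / 2))
        + (2 * real n powr (2/3) + C * (ln (ln (real n)) / ln z + 2) * real n powr (2/3) * ln (real n) powr (z - 1/3))"
      using A(1) by linarith
    also have "2 * real n powr (2/3) \<le> 2 * real n powr (2/3) * ln (real n) powr (z - 1/3)"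
    proof -
      have "exp 1 \<le> real n" using exp_le n by linarith
      then have "ln (real n) \<ge> 1" by (subst ln_ge_iff) (use n in auto)
      then have "ln (real n) powr (z - 1/3) \<ge> 1" using z by (intro ge_one_powr_ge_zero) auto
      then show ?thesis using mult_left_mono[of 1 _ "2 * real n powr (2/3)"] by simp
    qed
    also have "2 * real n powr (2/3) * ln (real n) powr (z - 1/3)
          + C * (ln (ln (real n)) / ln z + 2) * real n powr (2/3) * ln (real n) powr (z - 1/3)
        = real n powr (2/3) * ln (real n) powr (z - 1/3) * ((2 + 2 * C) + b * ln (ln (real n)))"
      by (simp add: b_def algebra_simps)
    also have "\<dots> \<le> real n powr (2/3) * ln (real n) powr (z - 1/3) * ln (real n) powr \<epsilon>"
      using n1[OF n(1)] by (intro mult_left_mono) auto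
    also have "\<dots> = real n powr (2/3) * ln (real n) powr (2 powr (1/3) - 1/3 + \<epsilon>)"
      by (simp add: z_def powr_add)
    finally show "real (F 6 n) \<le> real (prime_pi (real n)) + real (prime_pi (real n / 2))
      + real n powr (2/3) * ln (real n) powr (2 powr (1/3) - 1/3 + \<epsilon>)" by simp
  qed
qed

end
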